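(* Let $\Lambda$ be a realisation of the continuum sine kernel process on $\mathbb{R}$. Then almost surely the set of functions $\mathcal{E}_\Lambda=\{e_\lambda:\lambda\in\Lambda\}$, where $e_\lambda(x)=e^{i\lambda x}$, spans $L^2[-\pi,\pi]$.
   Context: A point process on a space $\Xi$ is determinantal with background measure $\mu$ and kernel $K:\Xi\times\Xi\to\mathbb{C}$ if for every $n\ge 1$ its $n$-point intensity function with respect to $\mu^{\otimes n}$ is $\rho_n(x_1,\dots,x_n)=\det\left(K(x_i,x_j)\right)_{i,j=1}^n$. The continuum sine kernel process is the determinantal point process on $\mathbb{R}$ whose background measure is Lebesgue measure and whose kernel is $K(x,y)=\frac{\sin\pi(x-y)}{\pi(x-y)}$ (with $K(x,x)=1$). A set of vectors spans a Hilbert space if its closed linear span is the whole space. *)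

theory Defs
  imports
    "HOL-Probability.Probability"
    "HOL-Library.Function_Algebras"
    "Jordan_Normal_Form.Determinant"
begin

text \<open>
  A point process is a random locally finite subset: counting functions of Borel sets are
  random variables. In a \<^class>\<open>heine_borel\<close> space, locally finite means that bounded
  sets contain finitely many points.
\<close>

definition num_points :: "'a set \<Rightarrow> ennreal"
  where "num_points A = emeasure (count_space UNIV) A"

definition point_process :: "'w measure \<Rightarrow> ('w \<Rightarrow> 'a::heine_borel set) \<Rightarrow> bool"
  where "point_process M X \<longleftrightarrow>
    prob_space M \<and>
    (\<forall>\<omega>\<in>space M. \<forall>B. bounded B \<longrightarrow> finite (X \<omega> \<inter> B)) \<and>
    (\<forall>B\<in>sets borel. (\<lambda>\<omega>. num_points (X \<omega> \<inter> B)) \<in> borel_measurable M)"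

text \<open>
  \<open>\<rho>\<close> is an \<open>n\<close>-point intensity with respect to \<open>\<mu>\<close> if it is the density, with respect to the
  \<open>n\<close>-fold product of \<open>\<mu>\<close>, of the measure sending \<open>B\<close> to the expected number of \<open>n\<close>-tuples of
  pairwise distinct points of the process that lie in \<open>B\<close>.
\<close>

definition distinct_tuples :: "nat \<Rightarrow> 'a set \<Rightarrow> (nat \<Rightarrow> 'a) set"
  where "distinct_tuples n S = {x \<in> {..<n} \<rightarrow>\<^sub>E S. inj_on x {..<n}}"

definition intensity_function ::
    "'w measure \<Rightarrow> ('w \<Rightarrow> 'a set) \<Rightarrow> 'a measure \<Rightarrow> nat \<Rightarrow> ((nat \<Rightarrow> 'a) \<Rightarrow> real) \<Rightarrow> bool"
  where "intensity_function M X \<mu> n \<rho> \<longleftrightarrow>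
    \<rho> \<in> borel_measurable (\<Pi>\<^sub>M i\<in>{..<n}. \<mu>) \<and>
    (\<forall>x\<in>space (\<Pi>\<^sub>M i\<in>{..<n}. \<mu>). 0 \<le> \<rho> x) \<and>
    (\<forall>B\<in>sets (\<Pi>\<^sub>M i\<in>{..<n}. \<mu>).
      (\<integral>\<^sup>+\<omega>. num_points (distinct_tuples n (X \<omega>) \<inter> B) \<partial>M) =
      (\<integral>\<^sup>+x\<in>B. ennreal (\<rho> x) \<partial>(\<Pi>\<^sub>M i\<in>{..<n}. \<mu>)))"

text \<open>
  \<open>Determinant.det\<close> is the determinant of matrices with term-level dimensions, as opposed to
  \<open>Determinants.det\<close> from HOL-Analysis.
\<close>

definition determinantal_process ::
    "'w measure \<Rightarrow> ('w \<Rightarrow> 'a::heine_borel set) \<Rightarrow> 'a measure \<Rightarrow> ('a \<Rightarrow> 'a \<Rightarrow> complex) \<Rightarrow> bool"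
  where "determinantal_process M X \<mu> K \<longleftrightarrow>
    point_process M X \<and> sets \<mu> = sets borel \<and> sigma_finite_measure \<mu> \<and>
    (\<forall>n\<ge>1. \<exists>\<rho>. intensity_function M X \<mu> n \<rho> \<and>
      (\<forall>x\<in>space (\<Pi>\<^sub>M i\<in>{..<n}. \<mu>).
        complex_of_real (\<rho> x) = Determinant.det (Matrix.mat n n (\<lambda>(i, j). K (x i) (x j)))))"

definition sine_kernel :: "real \<Rightarrow> real \<Rightarrow> complex"
  where "sine_kernel x y =
    (if x = y then 1 else complex_of_real (sin (pi * (x - y)) / (pi * (x - y))))"

definition sine_process :: "'w measure \<Rightarrow> ('w \<Rightarrow> real set) \<Rightarrow> bool"
  where "sine_process M \<Lambda> \<longleftrightarrow> determinantal_process M \<Lambda> lborel sine_kernel"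

text \<open>
  Elements of \<open>L\<^sup>2\<close> are represented by square-integrable functions, without passing to the
  quotient by almost everywhere equality; \<open>L2_norm\<close> is accordingly a seminorm, meaningful only
  on \<open>L2_space\<close>.
\<close>

definition L2_space :: "'a measure \<Rightarrow> ('a \<Rightarrow> complex) set"
  where "L2_space N = {f \<in> borel_measurable N. integrable N (\<lambda>x. (cmod (f x))\<^sup>2)}"

definition L2_norm :: "'a measure \<Rightarrow> ('a \<Rightarrow> complex) \<Rightarrow> real"
  where "L2_norm N f = sqrt (\<integral>x. (cmod (f x))\<^sup>2 \<partial>N)"

definition L2_closure :: "'a measure \<Rightarrow> ('a \<Rightarrow> complex) set \<Rightarrow> ('a \<Rightarrow> complex) set"
  where "L2_closure N S = {f \<in> L2_space N. \<forall>\<epsilon>>0. \<exists>g\<in>S. L2_norm N (f - g) < \<epsilon>}"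

interpretation cfun: vector_space "\<lambda>(c::complex) (f::'a \<Rightarrow> complex) x. c * f x"
  by unfold_locales (auto simp: fun_eq_iff algebra_simps)

definition spans_L2 :: "'a measure \<Rightarrow> ('a \<Rightarrow> complex) set \<Rightarrow> bool"
  where "spans_L2 N S \<longleftrightarrow> S \<subseteq> L2_space N \<and> L2_closure N (cfun.span S) = L2_space N"

definition exponential :: "real \<Rightarrow> real \<Rightarrow> complex"
  where "exponential l x = exp (\<i> * complex_of_real l * complex_of_real x)"

end

theory Submission
  imports Defs "HOL-Complex_Analysis.Complex_Analysis" "HOL-Real_Asymp.Real_Asymp"
begin

text \<open>
  Suppose that \<open>h \<noteq> 0\<close> in \<open>L\<^sup>2[-\<pi>, \<pi>]\<close> is orthogonal to all exponentials with frequencies in \<open>\<Lambda>\<close>. Its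
  Fourier transform \<open>F\<close> is entire, vanishes on \<open>\<Lambda>\<close>, and is bounded by \<open>C exp (\<pi>\<bar>y\<bar>) / sqrt (1 + \<bar>y\<bar>)\<close> on
  horizontal lines. If \<open>F(\<mu>) \<noteq> 0\<close>, then Jensen's formula centred at \<open>\<mu>\<close> gives
  \<open>S\<^sub>R := (\<Sum>\<lambda>. ln (R / \<bar>\<lambda> - \<mu>\<bar>)) \<le> 2R - (1/3) ln R + O(1)\<close>, where \<open>\<lambda>\<close> ranges over the points of
  \<open>\<Lambda>\<close> at distance less than \<open>R\<close> from \<open>\<mu>\<close>. For the sine process, \<open>S\<^sub>R\<close> (truncated near \<open>\<mu>\<close>) has mean
  \<open>2R - 2\<close> and variance \<open>O(ln R)\<close>, so by Chebyshev and Borel-Cantelli \<open>S\<^sub>R \<ge> 2R - 2 - (1/4) ln R\<close>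
  eventually along \<open>R = exp (n\<^sup>2)\<close>, a contradiction. It suffices to treat rational \<open>\<mu>\<close>, since the
  exponentials with rational frequencies span \<open>L\<^sup>2[-\<pi>, \<pi>]\<close>; and orthogonality to the finitely many
  exponentials involved in \<open>S\<^sub>R\<close> is enough, so that only finite-dimensional projections are needed.
\<close>

subsection \<open>Jensen's inequality\<close>

text \<open>Both sides of the comparison have the same main term:
  \<open>pi * R * \<bar>sin t\<bar>\<close> has circle mean \<open>2 * R\<close>, and points of
  density 1 give the sum a mean of the same size. The case is therefore critical, and the
  coefficients of \<open>ln R\<close> decide it. The decay
  \<open>1 / sqrt (1 + \<bar>y\<bar>)\<close> is worth \<open>ln R / 2\<close> on the circle; a
  crude estimate keeps \<open>ln R / 3\<close>. Any coefficient strictly between 0 and 1/3 can be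
  conceded to the fluctuations; the choice 1/4 leaves a surplus of \<open>ln R / 12\<close>.
  Chebyshev at a deviation proportional to \<open>ln R\<close>, with variance O(ln R), gives
  probability O(1 / ln R), which becomes summable for \<open>ln R = n^2\<close>. A variance of order
  (ln R)^2 would give no decay at all, which is why the energy integral is estimated with care. In
  the analytic half, \<open>h\<close> varies with \<open>R\<close>, but its squared norm stays above
  the squared distance from the exponential at \<open>\<mu>\<close> to the span, and this makes the
  constant in Jensen's inequality independent of \<open>R\<close>. Truncating the logarithm near
  \<open>\<mu>\<close> only lowers the sum, the harmless direction for a lower bound.\<close>

lemma integral_periodic_shift:
  fixes u :: "real \<Rightarrow> real"
  assumes cont: "continuous_on UNIV u" and per: "\<And>t. u (t + p) = u t"
    and \<theta>: "0 \<le> \<theta>" "\<theta> \<le> p"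
  shows "integral {\<theta>..\<theta> + p} u = integral {0..p} u"
proof -
  have int: "u integrable_on {a..b}" for a b
    by (intro integrable_continuous_interval continuous_on_subset[OF cont]) auto
  have "integral {\<theta>..\<theta> + p} u = integral {\<theta>..p} u + integral {p..\<theta> + p} u"
    using \<theta> by (intro Henstock_Kurzweil_Integration.integral_combine[symmetric] int) auto
  also have "integral {p..\<theta> + p} u = integral {0..\<theta>} (\<lambda>t. u (t + p))"
    using integral_shift[where f=u and a=0 and b=\<theta> and c=p] continuous_on_subset[OF cont] by (simp add: o_def)
  also have "\<dots> = integral {0..\<theta>} u" by (simp add: per)
  also have "integral {\<theta>..p} u + integral {0..\<theta>} u = integral {0..p} u"
    using Henstock_Kurzweil_Integration.integral_combine[OF \<theta> int] by simp
  finally show ?thesis .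
qed

text \<open>The maximum principle is applied to the product of \<open>N\<close> rotated copies of \<open>G\<close>: on the circle, the
  logarithm of its modulus is bounded by \<open>N\<close> times a Riemann sum of the mean of \<open>u\<close>. This avoids
  logarithms of \<open>G\<close>, which may have zeros.\<close>
lemma norm_center_le_exp_circle_mean:
  fixes G :: "complex \<Rightarrow> complex" and u :: "real \<Rightarrow> real"
  assumes holo: "G holomorphic_on UNIV" and R: "0 < R"
    and cont: "continuous_on UNIV u" and per: "\<And>t. u (t + 2 * pi) = u t"
    and bound: "\<And>t. norm (G (of_real R * cis t)) \<le> exp (u t)"
  shows "norm (G 0) \<le> exp (integral {0..2 * pi} u / (2 * pi))"
proof -
  define m where "m = integral {0..2 * pi} u / (2 * pi)"
  have int: "u integrable_on {a..b}" for a b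
    by (intro integrable_continuous_interval continuous_on_subset[OF cont]) auto
  have *: "norm (G 0) \<le> exp (m + \<delta>)" if \<delta>: "\<delta> > 0" for \<delta>
  proof -
    \<comment> \<open>The Riemann sums start at an angle up to \<open>2 * pi\<close> and run once
      round the circle, so they stay below \<open>4 * pi\<close>.\<close>
    have "uniformly_continuous_on {0..4 * pi} u"
      by (intro compact_uniformly_continuous continuous_on_subset[OF cont]) auto
    then obtain \<eta> where \<eta>: "\<eta> > 0"
      and u\<eta>: "\<And>x y. x \<in> {0..4 * pi} \<Longrightarrow> y \<in> {0..4 * pi} \<Longrightarrow> dist y x < \<eta> \<Longrightarrow> dist (u y) (u x) < \<delta>"
      unfolding uniformly_continuous_on_def using \<delta> by metis
    obtain N :: nat where N: "2 * pi / \<eta> < real N" using reals_Archimedean2 by blast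
    have N0: "N > 0" using N \<eta> by (cases N) (auto simp: divide_less_0_iff)
    define \<alpha> where "\<alpha> = 2 * pi / real N"
    have \<alpha>: "0 < \<alpha>" "\<alpha> < \<eta>" "real N * \<alpha> = 2 * pi"
      using N N0 \<eta> by (auto simp: \<alpha>_def field_simps)
    \<comment> \<open>The mesh is finer than the modulus of continuity, so lowering each node value
      by \<open>\<delta>\<close> makes the left-endpoint sum a lower bound, uniformly in the
      starting angle \<open>\<theta>\<close>.\<close>
    have riemann: "(\<Sum>k<n. \<alpha> * (u (\<theta> + real k * \<alpha>) - \<delta>)) \<le> integral {\<theta>..\<theta> + real n * \<alpha>} u"
      if \<theta>: "0 \<le> \<theta>" "\<theta> \<le> 2 * pi" and "n \<le> N" for \<theta> n
      using \<open>n \<le> N\<close>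
    proof (induction n)
      case (Suc n)
      let ?a = "\<theta> + real n * \<alpha>" and ?b = "\<theta> + real (Suc n) * \<alpha>"
      have b: "?b \<le> 4 * pi"
      proof -
        have "real (Suc n) * \<alpha> \<le> real N * \<alpha>" using Suc.prems \<alpha> by (intro mult_right_mono) auto
        then show ?thesis using \<alpha> \<theta> by simp
      qed
      have ab: "?a \<le> ?b" "\<theta> \<le> ?a" "?b - ?a = \<alpha>" using \<alpha> by (auto simp: algebra_simps)
      have "integral {?a..?b} (\<lambda>_. u ?a - \<delta>) \<le> integral {?a..?b} u"
      proof (intro integral_le int)
        fix t assume t: "t \<in> {?a..?b}"
        have "dist (u t) (u ?a) < \<delta>"
        proof (rule u\<eta>)
          have "?a \<le> t" "t \<le> ?b" using t by auto
          with ab \<theta> b \<alpha> show "?a \<in> {0..4 * pi}" "t \<in> {0..4 * pi}" "dist t ?a < \<eta>"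
            unfolding atLeastAtMost_iff dist_real_def by linarith+
        qed
        then show "u ?a - \<delta> \<le> u t" by (auto simp: dist_real_def)
      qed auto
      moreover have "integral {?a..?b} (\<lambda>_. u ?a - \<delta>) = \<alpha> * (u ?a - \<delta>)"
        using ab by simp
      moreover have "integral {\<theta>..?a} u + integral {?a..?b} u = integral {\<theta>..?b} u"
        using ab by (intro Henstock_Kurzweil_Integration.integral_combine int)
      moreover have "(\<Sum>k<n. \<alpha> * (u (\<theta> + real k * \<alpha>) - \<delta>)) \<le> integral {\<theta>..?a} u"
        using Suc by simp
      ultimately show ?case unfolding sum.lessThan_Suc by linarith
    qed simp
    define H where "H z = (\<Prod>k<N. G (cis (real k * \<alpha>) * z))" for z
    have "(\<lambda>z. G (c * z)) holomorphic_on UNIV" for c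
      using holomorphic_on_compose_gen[of "\<lambda>z. c * z" UNIV G UNIV] holo
      by (simp add: o_def holomorphic_intros)
    then have H: "H holomorphic_on UNIV"
      unfolding H_def by (intro holomorphic_on_prod)
    have "norm (H 0) \<le> exp (real N * (m + \<delta>))"
    proof (rule maximum_modulus_frontier[of H "cball 0 R"])
      show "H holomorphic_on interior (cball 0 R)" "continuous_on (closure (cball 0 R)) H"
        using H by (auto intro: holomorphic_on_subset holomorphic_on_imp_continuous_on)
    next
      fix z :: complex assume "z \<in> frontier (cball 0 R)"
      then have z: "norm z = R" using R by (simp add: frontier_cball)
      define \<theta> where "\<theta> = Arg2pi z"
      have z_eq: "z = of_real R * cis \<theta>"
        using Arg2pi_eq[of z] z by (simp add: \<theta>_def cis_conv_exp)
      have \<theta>: "0 \<le> \<theta>" "\<theta> \<le> 2 * pi"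
        using Arg2pi_ge_0 Arg2pi_lt_2pi[of z] by (auto simp: \<theta>_def)
      have "norm (H z) = (\<Prod>k<N. norm (G (of_real R * cis (\<theta> + real k * \<alpha>))))"
        by (simp add: H_def prod_norm z_eq flip: cis_mult) (simp add: mult_ac)
      also have "\<dots> \<le> (\<Prod>k<N. exp (u (\<theta> + real k * \<alpha>)))"
        by (intro prod_mono) (auto intro: bound)
      also have "\<dots> = exp (\<Sum>k<N. u (\<theta> + real k * \<alpha>))" by (simp add: exp_sum)
      also have "\<dots> \<le> exp (real N * (m + \<delta>))"
      proof -
        have "\<alpha> * ((\<Sum>k<N. u (\<theta> + real k * \<alpha>)) - real N * \<delta>) \<le> integral {\<theta>..\<theta> + 2 * pi} u"
          using riemann[OF \<theta> order_refl] \<alpha> by (simp add: sum_subtractf flip: sum_distrib_left)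
        also have "\<dots> = \<alpha> * (real N * m)"
          using integral_periodic_shift[OF cont per \<theta>] \<alpha>(3) by (simp add: m_def field_simps)
        finally have "(\<Sum>k<N. u (\<theta> + real k * \<alpha>)) - real N * \<delta> \<le> real N * m"
          using \<alpha>(1) by (simp only: mult_le_cancel_left_pos)
        then show ?thesis by (simp add: algebra_simps)
      qed
      finally show "norm (H z) \<le> exp (real N * (m + \<delta>))" .
    qed (use R in auto)
    \<comment> \<open>All rotations fix the centre, so both sides are \<open>N\<close>-th powers and
      taking roots restores the mean.\<close>
    also have "norm (H 0) = norm (G 0) ^ N" by (simp add: H_def prod_norm norm_power)
    also have "exp (real N * (m + \<delta>)) = exp (m + \<delta>) ^ N" by (rule exp_of_nat_mult)
    finally show ?thesis using N0 power_mono_iff[of "norm (G 0)" "exp (m + \<delta>)" N] by simp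
  qed
  have "norm (G 0) \<le> exp (m + 0)"
  proof (rule tendsto_lowerbound)
    show "((\<lambda>\<delta>. exp (m + \<delta>)) \<longlongrightarrow> exp (m + 0)) (at_right 0)" by (intro tendsto_intros)
    show "eventually (\<lambda>\<delta>. norm (G 0) \<le> exp (m + \<delta>)) (at_right 0)"
      by (intro eventually_at_rightI[of 0 1]) (auto intro: *)
  qed simp
  then show ?thesis by (simp add: m_def)
qed

text \<open>Zeros are removed one at a time. The factor
  \<open>((of_real R)\<^sup>2 - cnj a * z) / (of_real R * (z - a))\<close>, the reciprocal of a
  Blaschke factor, has modulus 1 on the circle of radius \<open>R\<close> and modulus
  \<open>R / norm a\<close> at 0: multiplying by it cancels the zero \<open>a\<close> and records it
  in the value at the centre.\<close>

lemma Blaschke_division: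
  fixes F :: "complex \<Rightarrow> complex"
  assumes "finite Z" "F holomorphic_on UNIV" "Z \<subseteq> ball 0 R - {0}" "\<And>l. l \<in> Z \<Longrightarrow> F l = 0"
  obtains G where "G holomorphic_on UNIV" "\<And>w. norm w = R \<Longrightarrow> norm (G w) = norm (F w)"
    "norm (G 0) = norm (F 0) * (\<Prod>l\<in>Z. R / norm l)"
proof -
  have "\<exists>G. G holomorphic_on UNIV \<and> (\<forall>w. norm w = R \<longrightarrow> norm (G w) = norm (F w)) \<and>
      norm (G 0) = norm (F 0) * (\<Prod>l\<in>Z. R / norm l)"
    using assms
  proof (induction Z arbitrary: F rule: finite_induct)
    case empty
    then show ?case by (intro exI[of _ F]) auto
  next
    case (insert a Z)
    have a: "norm a < R" "a \<noteq> 0" "F a = 0" using insert.prems by auto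
    have R: "R > 0" using a(1) norm_ge_zero[of a] by linarith
    \<comment> \<open>The value \<open>deriv F a\<close> fills the removable singularity, so the
      quotient is entire; it still vanishes at the remaining zeros.\<close>
    define q where "q z = (if z = a then deriv F a else (F z - F a) / (z - a))" for z
    have q: "q holomorphic_on UNIV"
      unfolding q_def using insert.prems by (intro pole_lemma) auto
    define F' where "F' z = q z * ((of_real R)\<^sup>2 - cnj a * z) / of_real R" for z
    have F': "F' holomorphic_on UNIV"
      unfolding F'_def using q R by (intro holomorphic_intros) auto
    have on_circle: "norm (F' w) = norm (F w)" if w: "norm w = R" for w
    proof -
      \<comment> \<open>On the circle, \<open>(of_real R)\<^sup>2 = w * cnj w\<close>.\<close>
      have "(of_real R)\<^sup>2 - cnj a * w = w * cnj (w - a)"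
        using w complex_norm_square[of w] by (simp add: algebra_simps)
      then have "norm ((of_real R)\<^sup>2 - cnj a * w) = R * norm (w - a)"
        using w by (simp add: norm_mult del: complex_cnj_diff)
      then show ?thesis
        using w a R by (auto simp: F'_def q_def norm_mult norm_divide)
    qed
    have at_0: "norm (F' 0) = norm (F 0) * (R / norm a)"
      using a R by (simp add: F'_def q_def norm_mult norm_divide norm_power power2_eq_square)
    have "F' l = 0" if "l \<in> Z" for l
      using insert that by (auto simp: F'_def q_def)
    with insert.IH[OF F'] insert.prems obtain G where G: "G holomorphic_on UNIV"
      "\<And>w. norm w = R \<Longrightarrow> norm (G w) = norm (F' w)"
      "norm (G 0) = norm (F' 0) * (\<Prod>l\<in>Z. R / norm l)" by blast
    then show ?case
      using insert.hyps on_circle at_0 by (intro exI[of _ G]) (auto simp: mult_ac)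
  qed
  with that show ?thesis by blast
qed

text \<open>Dividing out the zeros in \<open>Z\<close> leaves the modulus on the circle unchanged,
  so a continuous majorant \<open>u\<close> of the logarithm of that modulus controls the centre.
  Stating this with \<open>u\<close> instead of the logarithm itself permits zeros on the circle and
  zeros outside \<open>Z\<close>.\<close>

lemma Jensen_inequality:
  fixes F :: "complex \<Rightarrow> complex" and u :: "real \<Rightarrow> real"
  assumes "F holomorphic_on UNIV" "0 < R"
    and "finite Z" "Z \<subseteq> ball 0 R - {0}" "\<And>l. l \<in> Z \<Longrightarrow> F l = 0"
    and "continuous_on UNIV u" "\<And>t. u (t + 2 * pi) = u t"
    and bound: "\<And>t. norm (F (of_real R * cis t)) \<le> exp (u t)"
  shows "norm (F 0) * (\<Prod>l\<in>Z. R / norm l) \<le> exp (integral {0..2 * pi} u / (2 * pi))"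
proof -
  obtain G where G: "G holomorphic_on UNIV" "\<And>w. norm w = R \<Longrightarrow> norm (G w) = norm (F w)"
    "norm (G 0) = norm (F 0) * (\<Prod>l\<in>Z. R / norm l)"
    using Blaschke_division[OF assms(3,1,4,5)] by blast
  have "norm (G (of_real R * cis t)) \<le> exp (u t)" for t
    using G(2)[of "of_real R * cis t"] bound[of t] \<open>0 < R\<close> by (simp add: norm_mult)
  from norm_center_le_exp_circle_mean[OF G(1) \<open>0 < R\<close> assms(6,7) this] G(3) show ?thesis by simp
qed

section \<open>Circle means of the growth bound\<close>

lemma integral_double_half_period:
  fixes g :: "real \<Rightarrow> real"
  assumes cont: "continuous_on UNIV g" and per: "\<And>t. g (t + pi) = g t"
  shows "integral {0..2 * pi} g = 2 * integral {0..pi} g"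
proof -
  have int: "g integrable_on {a..b}" for a b
    by (intro integrable_continuous_interval continuous_on_subset[OF cont]) auto
  have "integral {0..pi} g + integral {pi..pi + pi} g = integral {0..pi + pi} g"
    by (intro Henstock_Kurzweil_Integration.integral_combine int) auto
  moreover have "integral {pi..pi + pi} g = integral {0..pi} g"
    by (rule integral_periodic_shift[OF cont per]) auto
  ultimately show ?thesis by (simp only: mult_2)
qed

text \<open>Keeping only the arcs with \<open>1/2 \<le> \<bar>sin t\<bar>\<close>, two thirds of the
  circle, costs a third of the asymptotic mean \<open>ln R\<close>. Halved by the square root in the
  growth bound, what remains is \<open>ln (R / 2) / 3\<close>.\<close>

lemma integral_ln_sin_ge:
  assumes R: "2 \<le> R"
  shows "4 * pi / 3 * ln (R / 2) \<le> integral {0..2 * pi} (\<lambda>t. ln (1 + R * \<bar>sin t\<bar>))"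
proof -
  let ?g = "\<lambda>t. ln (1 + R * \<bar>sin t\<bar>)"
  have pos: "0 < 1 + R * \<bar>sin t\<bar>" for t using R by (simp add: add_pos_nonneg)
  have cont: "continuous_on UNIV ?g"
    using less_imp_neq[OF pos] by (intro continuous_intros) auto
  have int: "?g integrable_on {a..b}" for a b
    by (intro integrable_continuous_interval continuous_on_subset[OF cont]) auto
  have "2 * pi / 3 * ln (R / 2) = integral {pi/6..5*pi/6} (\<lambda>_. ln (R / 2))" by simp
  also have "\<dots> \<le> integral {pi/6..5*pi/6} ?g"
  proof (intro integral_le int)
    fix t assume t: "t \<in> {pi/6..5*pi/6}"
    have "pi / 6 \<le> t" "t \<le> 5 * pi / 6" using t by auto
    then have "\<bar>t - pi/2\<bar> \<le> pi / 3" by linarith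
    then have "cos (pi/3) \<le> cos \<bar>t - pi/2\<bar>" by (intro cos_monotone_0_pi_le) auto
    also have "cos \<bar>t - pi/2\<bar> = sin t" by (simp add: cos_diff)
    finally have "1/2 \<le> sin t" by (simp add: cos_60)
    then have "R * (1/2) \<le> R * \<bar>sin t\<bar>" using R by (intro mult_left_mono) linarith+
    then have "R / 2 \<le> 1 + R * \<bar>sin t\<bar>" by linarith
    then show "ln (R / 2) \<le> ?g t" using R by (subst ln_le_cancel_iff) (auto intro: pos)
  qed auto
  also have "\<dots> \<le> integral {0..pi} ?g"
    using R by (intro integral_subset_le int) auto
  finally show ?thesis
    using integral_double_half_period[OF cont] by simp
qed

lemma integral_abs_sin: "integral {0..2 * pi} (\<lambda>t. \<bar>sin t\<bar>) = 4"
proof -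
  have "integral {0..pi} (\<lambda>t. \<bar>sin t\<bar>) = integral {0..pi} sin"
    by (intro Henstock_Kurzweil_Integration.integral_cong) (auto simp: sin_ge_zero)
  also have "(sin has_integral (- cos pi - - cos 0)) {0..pi}"
    by (intro fundamental_theorem_of_calculus)
      (auto intro!: derivative_eq_intros simp flip: has_real_derivative_iff_has_vector_derivative)
  then have "integral {0..pi} sin = 2" by (simp add: integral_unique)
  finally show ?thesis
    by (subst integral_double_half_period) (auto intro!: continuous_intros)
qed

text \<open>
  The factor \<open>(1 + \<bar>Im z\<bar>) powr (-1/2)\<close>, which square integrability provides, gains \<open>ln R / 3\<close>
  over the density \<open>2 * R\<close>. This gain is what beats the fluctuations of the process.
\<close>
lemma Jensen_Paley_Wiener:
  fixes F :: "complex \<Rightarrow> complex"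
  assumes F: "F holomorphic_on UNIV" and R: "2 \<le> R" and C: "0 < C"
    and Z: "finite Z" "Z \<subseteq> ball 0 R - {0}" "\<And>l. l \<in> Z \<Longrightarrow> F l = 0"
    and bound: "\<And>z. norm (F z) \<le> C * exp (pi * \<bar>Im z\<bar>) / sqrt (1 + \<bar>Im z\<bar>)"
  shows "norm (F 0) * (\<Prod>l\<in>Z. R / norm l) \<le> C * exp (2 * R - ln (R / 2) / 3)"
proof -
  define u where "u t = ln C + (pi * R * \<bar>sin t\<bar> - ln (1 + R * \<bar>sin t\<bar>) / 2)" for t
  have pos: "0 < 1 + R * \<bar>sin t\<bar>" for t using R by (simp add: add_pos_nonneg)
  have cont: "continuous_on UNIV (\<lambda>t. ln (1 + R * \<bar>sin t\<bar>))"
    using less_imp_neq[OF pos] by (intro continuous_intros) auto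
  have int: "(\<lambda>t. ln (1 + R * \<bar>sin t\<bar>)) integrable_on {0..2*pi}"
    by (intro integrable_continuous_interval continuous_on_subset[OF cont]) auto
  have "norm (F 0) * (\<Prod>l\<in>Z. R / norm l) \<le> exp (integral {0..2 * pi} u / (2 * pi))"
  proof (rule Jensen_inequality[OF F _ Z])
    show "continuous_on UNIV u"
      unfolding u_def by (intro continuous_intros cont) auto
    show "norm (F (of_real R * cis t)) \<le> exp (u t)" for t
    proof -
      have "\<bar>Im (of_real R * cis t)\<bar> = R * \<bar>sin t\<bar>" using R by (simp add: abs_mult)
      moreover have "exp (ln (1 + R * \<bar>sin t\<bar>) / 2) = sqrt (1 + R * \<bar>sin t\<bar>)"
        using pos[of t] by (metis ln_sqrt exp_ln real_sqrt_gt_zero less_imp_le)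
      moreover have "norm (F (of_real R * cis t)) \<le>
          C * exp (pi * \<bar>Im (of_real R * cis t)\<bar>) / sqrt (1 + \<bar>Im (of_real R * cis t)\<bar>)"
        by (rule bound)
      ultimately show ?thesis
        using C by (simp only: u_def exp_add exp_diff exp_ln mult.assoc times_divide_eq_right)
    qed
  qed (use R in \<open>auto simp: u_def\<close>)
  \<comment> \<open>Division by \<open>2 * pi\<close> turns \<open>pi * R * 4\<close> into
    \<open>2 * R\<close>, the term that the mean of the process has to match.\<close>
  moreover have "integral {0..2 * pi} u = 2 * pi * ln C + (pi * R * 4
      - integral {0..2 * pi} (\<lambda>t. ln (1 + R * \<bar>sin t\<bar>)) / 2)"
  proof -
    have "(u has_integral (measure lborel {0..2*pi} *\<^sub>R ln C + (pi * R * 4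
      - integral {0..2 * pi} (\<lambda>t. ln (1 + R * \<bar>sin t\<bar>)) / 2))) {0..2*pi}"
      unfolding u_def
    proof (intro has_integral_add has_integral_diff has_integral_divide has_integral_mult_right
        has_integral_const_real integrable_integral int)
      show "((\<lambda>t. \<bar>sin t\<bar>) has_integral 4) {0..2 * pi}"
        unfolding has_integral_iff using integral_abs_sin
        by (auto intro!: integrable_continuous_interval continuous_intros)
    qed
    then show ?thesis by (simp add: integral_unique)
  qed
  ultimately have "norm (F 0) * (\<Prod>l\<in>Z. R / norm l) \<le> exp (ln C + (2 * R - ln (R / 2) / 3))"
    using integral_ln_sin_ge[OF R]
    by (elim order.trans) (simp add: field_simps)
  then show ?thesis using C by (simp add: exp_add)
qed

subsection \<open>Square-integrable functions\<close>

lemma borel_measurable_L2_space: "f \<in> L2_space N \<Longrightarrow> f \<in> borel_measurable N"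
  and integrable_norm_square_L2_space: "f \<in> L2_space N \<Longrightarrow> integrable N (\<lambda>x. (cmod (f x))\<^sup>2)"
  by (auto simp: L2_space_def)

lemma norm_add_square_le: "(norm (a + b))\<^sup>2 \<le> 2 * (norm a)\<^sup>2 + 2 * (norm b)\<^sup>2"
  for a b :: "'a::real_normed_vector"
proof -
  have "(norm (a + b))\<^sup>2 \<le> (norm a + norm b)\<^sup>2" by (intro power_mono norm_triangle_ineq) auto
  also have "\<dots> \<le> 2 * (norm a)\<^sup>2 + 2 * (norm b)\<^sup>2"
    using sum_squares_bound[of "norm a" "norm b"] by (simp add: power2_sum)
  finally show ?thesis .
qed

lemma L2_space_add:
  assumes f: "f \<in> L2_space N" and g: "g \<in> L2_space N"
  shows "(\<lambda>x. f x + g x) \<in> L2_space N"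
proof -
  have "integrable N (\<lambda>x. (cmod (f x + g x))\<^sup>2)"
  proof (rule Bochner_Integration.integrable_bound)
    show "integrable N (\<lambda>x. 2 * (cmod (f x))\<^sup>2 + 2 * (cmod (g x))\<^sup>2)"
      using f g by (auto simp: L2_space_def)
  qed (use f g in \<open>auto simp: L2_space_def norm_add_square_le\<close>)
  then show ?thesis using f g by (auto simp: L2_space_def)
qed

lemma L2_space_scale: "f \<in> L2_space N \<Longrightarrow> (\<lambda>x. c * f x) \<in> L2_space N"
  by (auto simp: L2_space_def norm_mult power_mult_distrib)

lemma L2_space_diff:
  assumes "f \<in> L2_space N" "g \<in> L2_space N"
  shows "(\<lambda>x. f x - g x) \<in> L2_space N"
  using L2_space_add[OF assms(1) L2_space_scale[OF assms(2), of "-1"]] by simp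

lemma subspace_L2_space: "cfun.subspace (L2_space N)"
  unfolding cfun.subspace_def
  by (auto simp: L2_space_scale plus_fun_def L2_space_add) (simp add: L2_space_def zero_fun_def)

text \<open>Integrals of squares in place of \<open>L2_norm\<close> remove square roots from all
  later approximations.\<close>

lemma L2_closureI:
  assumes "f \<in> L2_space N" "\<And>\<epsilon>. \<epsilon> > 0 \<Longrightarrow> \<exists>g\<in>S. (\<integral>x. (cmod (f x - g x))\<^sup>2 \<partial>N) < \<epsilon>"
  shows "f \<in> L2_closure N S"
  unfolding L2_closure_def
proof (safe intro!: assms(1))
  fix \<epsilon> :: real assume \<epsilon>: "\<epsilon> > 0"
  obtain g where "g \<in> S" "(\<integral>x. (cmod (f x - g x))\<^sup>2 \<partial>N) < \<epsilon>\<^sup>2" using assms(2)[of "\<epsilon>\<^sup>2"] \<epsilon> by auto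
  then show "\<exists>g\<in>S. L2_norm N (f - g) < \<epsilon>"
    using \<epsilon> by (intro bexI[of _ g]) (auto simp: L2_norm_def real_less_lsqrt)
qed

lemma L2_closureD:
  assumes "f \<in> L2_closure N S" "\<epsilon> > 0"
  obtains g where "g \<in> S" "(\<integral>x. (cmod (f x - g x))\<^sup>2 \<partial>N) < \<epsilon>"
proof -
  obtain g where "g \<in> S" "L2_norm N (f - g) < sqrt \<epsilon>"
    using assms unfolding L2_closure_def by (auto dest: spec[of _ "sqrt \<epsilon>"])
  with that[of g] show ?thesis by (simp add: L2_norm_def)
qed

lemma L2_closure_subset_L2_space: "L2_closure N S \<subseteq> L2_space N"
  by (auto simp: L2_closure_def)

lemma subset_L2_closure: "S \<subseteq> L2_space N \<Longrightarrow> S \<subseteq> L2_closure N S"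
  by (intro subsetI L2_closureI) (auto intro!: bexI[where P="\<lambda>g. (\<integral>x. (cmod (_ x - g x))\<^sup>2 \<partial>N) < _"])

text \<open>The factor 2 stands in for Minkowski's inequality; it is the reason for the tolerances
  \<open>\<epsilon> / 4\<close> wherever two errors are added below.\<close>

lemma integral_norm_square_add_le:
  assumes f: "f \<in> L2_space N" and g: "g \<in> L2_space N"
  shows "(\<integral>x. (cmod (f x + g x))\<^sup>2 \<partial>N) \<le> 2 * (\<integral>x. (cmod (f x))\<^sup>2 \<partial>N) + 2 * (\<integral>x. (cmod (g x))\<^sup>2 \<partial>N)"
proof -
  have "(\<integral>x. (cmod (f x + g x))\<^sup>2 \<partial>N) \<le> (\<integral>x. 2 * (cmod (f x))\<^sup>2 + 2 * (cmod (g x))\<^sup>2 \<partial>N)"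
    using f g L2_space_add[OF f g]
    by (intro integral_mono norm_add_square_le) (auto simp: L2_space_def)
  then show ?thesis using f g by (simp add: L2_space_def)
qed

text \<open>Closedness of the closure. It serves for dominated limits of functions in the closure,
  and for passing from the span of the rational exponentials to the whole space.\<close>

lemma L2_closure_idem:
  assumes f: "f \<in> L2_space N" and S: "S \<subseteq> L2_space N"
    and approx: "\<And>\<epsilon>. \<epsilon> > 0 \<Longrightarrow> \<exists>g\<in>L2_closure N S. (\<integral>x. (cmod (f x - g x))\<^sup>2 \<partial>N) < \<epsilon>"
  shows "f \<in> L2_closure N S"
proof (rule L2_closureI[OF f])
  fix \<epsilon> :: real assume \<epsilon>: "\<epsilon> > 0"
  obtain g where g: "g \<in> L2_closure N S" "(\<integral>x. (cmod (f x - g x))\<^sup>2 \<partial>N) < \<epsilon> / 4"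
    using approx[of "\<epsilon> / 4"] \<epsilon> by auto
  obtain h where h: "h \<in> S" "(\<integral>x. (cmod (g x - h x))\<^sup>2 \<partial>N) < \<epsilon> / 4"
    using L2_closureD[OF g(1), of "\<epsilon> / 4"] \<epsilon> by auto
  have "g \<in> L2_space N" "h \<in> L2_space N" using g h S L2_closure_subset_L2_space by auto
  then have "(\<integral>x. (cmod ((f x - g x) + (g x - h x)))\<^sup>2 \<partial>N) < \<epsilon>"
    using integral_norm_square_add_le[OF L2_space_diff[OF f] L2_space_diff, of g g h] g h by linarith
  then show "\<exists>g\<in>S. (\<integral>x. (cmod (f x - g x))\<^sup>2 \<partial>N) < \<epsilon>" using h by auto
qed

lemma subspace_L2_closure:
  assumes S: "S \<subseteq> L2_space N" and sub: "cfun.subspace S"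
  shows "cfun.subspace (L2_closure N S)"
  unfolding cfun.subspace_def
proof (intro conjI ballI allI)
  show "0 \<in> L2_closure N S"
    using subset_L2_closure[OF S] cfun.subspace_0[OF sub] by auto
next
  fix f g assume fg: "f \<in> L2_closure N S" "g \<in> L2_closure N S"
  then have L2: "f \<in> L2_space N" "g \<in> L2_space N" using L2_closure_subset_L2_space by auto
  show "f + g \<in> L2_closure N S"
  proof (rule L2_closureI)
    show "f + g \<in> L2_space N" using L2_space_add[OF L2] by (simp add: plus_fun_def)
    fix \<epsilon> :: real assume \<epsilon>: "\<epsilon> > 0"
    obtain f' where f': "f' \<in> S" "(\<integral>x. (cmod (f x - f' x))\<^sup>2 \<partial>N) < \<epsilon> / 4"
      using L2_closureD[OF fg(1), of "\<epsilon> / 4"] \<epsilon> by auto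
    obtain g' where g': "g' \<in> S" "(\<integral>x. (cmod (g x - g' x))\<^sup>2 \<partial>N) < \<epsilon> / 4"
      using L2_closureD[OF fg(2), of "\<epsilon> / 4"] \<epsilon> by auto
    have "f' \<in> L2_space N" "g' \<in> L2_space N" using f' g' S by auto
    then have "(\<integral>x. (cmod ((f x - f' x) + (g x - g' x)))\<^sup>2 \<partial>N) < \<epsilon>"
      using integral_norm_square_add_le[OF L2_space_diff[OF L2(1)] L2_space_diff[OF L2(2)], of f' g'] f' g'
      by linarith
    then show "\<exists>h\<in>S. (\<integral>x. (cmod ((f + g) x - h x))\<^sup>2 \<partial>N) < \<epsilon>"
      using cfun.subspace_add[OF sub f'(1) g'(1)]
      by (intro bexI[of _ "f' + g'"]) (auto simp: add_diff_add)
  qed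
next
  fix c f assume f: "f \<in> L2_closure N S"
  show "(\<lambda>x. c * f x) \<in> L2_closure N S"
  proof (rule L2_closureI)
    show "(\<lambda>x. c * f x) \<in> L2_space N"
      using f L2_closure_subset_L2_space by (auto intro: L2_space_scale)
    fix \<epsilon> :: real assume \<epsilon>: "\<epsilon> > 0"
    \<comment> \<open>The summand 1 keeps the tolerance positive when \<open>c = 0\<close>.\<close>
    obtain g where g: "g \<in> S" "(\<integral>x. (cmod (f x - g x))\<^sup>2 \<partial>N) < \<epsilon> / ((cmod c)\<^sup>2 + 1)"
      using L2_closureD[OF f, of "\<epsilon> / ((cmod c)\<^sup>2 + 1)"] \<epsilon> by (auto simp: add_nonneg_pos)
    have "(\<integral>x. (cmod (c * f x - c * g x))\<^sup>2 \<partial>N) = (cmod c)\<^sup>2 * (\<integral>x. (cmod (f x - g x))\<^sup>2 \<partial>N)"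
      by (simp add: norm_mult power_mult_distrib flip: right_diff_distrib)
    also have "\<dots> \<le> ((cmod c)\<^sup>2 + 1) * (\<integral>x. (cmod (f x - g x))\<^sup>2 \<partial>N)"
      by (intro mult_right_mono) (auto intro: integral_nonneg_AE)
    also have "\<dots> < \<epsilon>"
      using g(2) by (simp add: pos_less_divide_eq add_nonneg_pos mult.commute)
    finally show "\<exists>g\<in>S. (\<integral>x. (cmod (c * f x - g x))\<^sup>2 \<partial>N) < \<epsilon>"
      using cfun.subspace_scale[OF sub g(1), of c] by (intro bexI[of _ "\<lambda>x. c * g x"])
  qed
qed

section \<open>Inner products and projections onto finite-dimensional spans\<close>

lemma borel_measurable_cnj [measurable (raw)]:
  "f \<in> borel_measurable N \<Longrightarrow> (\<lambda>x. cnj (f x)) \<in> borel_measurable N"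
  by (rule borel_measurable_continuous_on[of cnj]) (auto intro: continuous_intros)

definition L2_inner :: "'a measure \<Rightarrow> ('a \<Rightarrow> complex) \<Rightarrow> ('a \<Rightarrow> complex) \<Rightarrow> complex"
  where "L2_inner N f g = (\<integral>x. f x * cnj (g x) \<partial>N)"

lemma integrable_L2_inner:
  assumes f: "f \<in> L2_space N" and g: "g \<in> L2_space N"
  shows "integrable N (\<lambda>x. f x * cnj (g x))"
proof (rule Bochner_Integration.integrable_bound)
  show "integrable N (\<lambda>x. (cmod (f x))\<^sup>2 + (cmod (g x))\<^sup>2)"
    using f g by (auto simp: L2_space_def)
  have "cmod (f x * cnj (g x)) \<le> norm ((cmod (f x))\<^sup>2 + (cmod (g x))\<^sup>2)" for x
    using sum_squares_bound[of "cmod (f x)" "cmod (g x)"] mult_nonneg_nonneg[of "cmod (f x)" "cmod (g x)"]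
    by (simp add: norm_mult del: mult_nonneg_nonneg)
  then show "AE x in N. norm (f x * cnj (g x)) \<le> norm ((cmod (f x))\<^sup>2 + (cmod (g x))\<^sup>2)" by simp
qed (use f g in \<open>auto simp: L2_space_def\<close>)

lemma L2_inner_diff_left:
  "f \<in> L2_space N \<Longrightarrow> g \<in> L2_space N \<Longrightarrow> h \<in> L2_space N \<Longrightarrow>
    L2_inner N (\<lambda>x. f x - g x) h = L2_inner N f h - L2_inner N g h"
  by (simp add: L2_inner_def left_diff_distrib integrable_L2_inner)

lemma L2_inner_add_right:
  "f \<in> L2_space N \<Longrightarrow> g \<in> L2_space N \<Longrightarrow> h \<in> L2_space N \<Longrightarrow>
    L2_inner N h (\<lambda>x. f x + g x) = L2_inner N h f + L2_inner N h g"
  by (simp add: L2_inner_def distrib_left integrable_L2_inner)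

lemma L2_inner_scale_left: "L2_inner N (\<lambda>x. c * f x) h = c * L2_inner N f h"
  by (simp add: L2_inner_def mult.assoc)

lemma L2_inner_scale_right: "L2_inner N f (\<lambda>x. c * g x) = cnj c * L2_inner N f g"
  unfolding L2_inner_def by (subst integral_mult_right_zero[symmetric]) (simp add: mult_ac)

lemma L2_inner_self: "L2_inner N f f = of_real (\<integral>x. (cmod (f x))\<^sup>2 \<partial>N)"
  unfolding L2_inner_def by (simp add: complex_norm_square[symmetric] flip: of_real_power)

lemma L2_inner_span_eq_0:
  assumes A: "A \<subseteq> L2_space N" and h: "h \<in> L2_space N" and orth: "\<And>a. a \<in> A \<Longrightarrow> L2_inner N h a = 0"
    and g: "g \<in> cfun.span A"
  shows "L2_inner N h g = 0"
proof -
  have "cfun.subspace {g \<in> L2_space N. L2_inner N h g = 0}"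
    using subspace_L2_space[of N] h unfolding cfun.subspace_def
    by (auto simp: plus_fun_def L2_inner_add_right L2_inner_scale_right)
      (simp add: L2_inner_def)
  then have "cfun.span A \<subseteq> {g \<in> L2_space N. L2_inner N h g = 0}"
    using A orth by (intro cfun.span_minimal) auto
  then show ?thesis using g by auto
qed

lemma span_subset_L2_space: "A \<subseteq> L2_space N \<Longrightarrow> cfun.span A \<subseteq> L2_space N"
  by (intro cfun.span_minimal subspace_L2_space)

text \<open>Gram-Schmidt: the induction hypothesis is applied both to the new vector
  \<open>a\<close> and to \<open>f\<close>, hence the generalisation over \<open>f\<close>; the
  component of the residual \<open>h\<close> along the residual \<open>a'\<close> is then
  subtracted.\<close>

lemma finite_orthogonal_projection:
  assumes "finite A" "A \<subseteq> L2_space N" "f \<in> L2_space N"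
  shows "\<exists>g\<in>cfun.span A. \<forall>a\<in>A. L2_inner N (\<lambda>x. f x - g x) a = 0"
  using assms
proof (induction A arbitrary: f rule: finite_induct)
  case empty
  then show ?case by (auto intro: cfun.span_zero)
next
  case (insert a A)
  have A: "A \<subseteq> L2_space N" "a \<in> L2_space N" and f: "f \<in> L2_space N" using insert.prems by auto
  note span = subsetD[OF span_subset_L2_space[OF A(1)]]
  obtain p where p: "p \<in> cfun.span A" "\<And>b. b \<in> A \<Longrightarrow> L2_inner N (\<lambda>x. a x - p x) b = 0"
    using insert.IH[OF A] by blast
  obtain q where q: "q \<in> cfun.span A" "\<And>b. b \<in> A \<Longrightarrow> L2_inner N (\<lambda>x. f x - q x) b = 0"
    using insert.IH[OF A(1) f] by blast
  define a' where "a' = (\<lambda>x. a x - p x)"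
  define h where "h = (\<lambda>x. f x - q x)"
  have a': "a' \<in> L2_space N" unfolding a'_def by (intro L2_space_diff A span p)
  have h: "h \<in> L2_space N" unfolding h_def by (intro L2_space_diff f span q)
  define c where "c = L2_inner N h a' / L2_inner N a' a'"
  have h_c: "(\<lambda>x. h x - c * a' x) \<in> L2_space N"
    by (intro L2_space_diff L2_space_scale h a')
  have ha': "L2_inner N (\<lambda>x. h x - c * a' x) a' = 0"
  \<comment> \<open>\<open>L2_inner\<close> is only semidefinite on functions. If \<open>a'\<close>
    has seminorm 0, it vanishes almost everywhere, and so does the integrand of any inner product
    with it.\<close>
  proof (cases "L2_inner N a' a' = 0")
    case True
    then have "(\<integral>x. (cmod (a' x))\<^sup>2 \<partial>N) = 0" by (simp add: L2_inner_self)
    then have "AE x in N. (cmod (a' x))\<^sup>2 = 0"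
      using a' by (subst (asm) integral_nonneg_eq_0_iff_AE) (auto simp: L2_space_def)
    then have "L2_inner N (\<lambda>x. h x - c * a' x) a' = (\<integral>x. 0 \<partial>N)"
      unfolding L2_inner_def using h a' borel_measurable_L2_space[OF h_c] by (intro integral_cong_AE) (auto simp: L2_space_def)
    then show ?thesis by simp
  next
    case False
    have "L2_inner N (\<lambda>x. h x - c * a' x) a' = L2_inner N h a' - c * L2_inner N a' a'"
      by (simp only: L2_inner_diff_left[OF h L2_space_scale[OF a'] a'] L2_inner_scale_left)
    with False show ?thesis by (simp add: c_def)
  qed
  have orth: "L2_inner N (\<lambda>x. h x - c * a' x) b = 0" if "b \<in> A" for b
  proof -
    have "b \<in> L2_space N" using A that by auto
    then have "L2_inner N (\<lambda>x. h x - c * a' x) b = L2_inner N h b - c * L2_inner N a' b"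
      by (simp add: L2_inner_diff_left[OF h L2_space_scale[OF a']] L2_inner_scale_left)
    also have "\<dots> = 0" using p(2) q(2) that by (simp add: a'_def h_def)
    finally show ?thesis .
  qed
  define g where "g = q + (\<lambda>x. c * a' x)"
  have "a' \<in> cfun.span (insert a A)"
    using cfun.span_diff[OF cfun.span_base[of a "insert a A"], of p] p(1)
      cfun.span_mono[of A "insert a A"] by (auto simp: a'_def fun_diff_def)
  then have "g \<in> cfun.span (insert a A)"
    using q(1) cfun.span_mono[of A "insert a A"] unfolding g_def
    by (intro cfun.span_add cfun.span_scale) auto
  moreover have "(\<lambda>x. f x - g x) = (\<lambda>x. h x - c * a' x)" by (auto simp: g_def h_def)
  \<comment> \<open>Since \<open>a = a' + p\<close>, orthogonality to \<open>a'\<close> and to the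
    span of \<open>A\<close>, which contains \<open>p\<close>, is enough.\<close>
  moreover have "L2_inner N (\<lambda>x. h x - c * a' x) a = 0"
    using L2_inner_add_right[OF a' span[OF p(1)] h_c] ha' L2_inner_span_eq_0[OF A(1) h_c orth p(1)]
    by (simp add: a'_def)
  ultimately show ?case using orth by (auto intro!: bexI[of _ g])
qed

subsection \<open>Exponentials on an interval\<close>

text \<open>For \<open>B > 0\<close>, the radial retraction of the plane onto the closed disc of
  radius \<open>B\<close>. Writing the factor with \<open>max\<close> makes continuity across the
  boundary circle immediate.\<close>

definition radial_clip :: "real \<Rightarrow> complex \<Rightarrow> complex"
  where "radial_clip B z = of_real (B / max B (cmod z)) * z"

lemma continuous_on_exponential: "continuous_on S (exponential l)"
  unfolding exponential_def by (intro continuous_intros)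

lemma continuous_in_L2_space:
  fixes f :: "real \<Rightarrow> complex"
  assumes f: "continuous_on {a..b} f"
  shows "f \<in> L2_space (lebesgue_on {a..b})"
proof -
  have "continuous_on {a..b} (\<lambda>x. (cmod (f x))\<^sup>2)" by (intro continuous_intros f)
  then have "integrable (lebesgue_on {a..b}) (\<lambda>x. (cmod (f x))\<^sup>2)"
    by (rule continuous_imp_integrable_real)
  moreover have "f \<in> borel_measurable (lebesgue_on {a..b})"
    using f by (intro continuous_imp_measurable_on_sets_lebesgue) auto
  ultimately show ?thesis by (simp add: L2_space_def)
qed

lemma exponential_in_L2_space: "exponential ` S \<subseteq> L2_space (lebesgue_on {a..b})"
  by (auto intro: continuous_in_L2_space continuous_on_exponential)

section \<open>Density of the exponentials with rational frequencies\<close>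

lemma span_exponential_mult:
  assumes S: "\<And>a b. a \<in> S \<Longrightarrow> b \<in> S \<Longrightarrow> a + b \<in> S"
    and f: "f \<in> cfun.span (exponential ` S)" and g: "g \<in> cfun.span (exponential ` S)"
  shows "(\<lambda>x. f x * g x) \<in> cfun.span (exponential ` S)"
proof -
  let ?V = "cfun.span (exponential ` S)"
  \<comment> \<open>Multiplication is bilinear, so the claim reduces to generators, first in one
    factor and then in the other.\<close>
  have sub: "cfun.subspace {f. (\<lambda>x. f x * g x) \<in> ?V}" for g
    unfolding cfun.subspace_def
  proof (safe, goal_cases)
    case 1
    have "(\<lambda>x. (0 :: real \<Rightarrow> complex) x * g x) = 0" by auto
    then show ?case by (metis cfun.span_zero)
  next
    case (2 u v)
    have "(\<lambda>x. (u + v) x * g x) = (\<lambda>x. u x * g x) + (\<lambda>x. v x * g x)"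
      by (auto simp: distrib_right)
    with cfun.span_add[OF 2] show ?case by simp
  next
    case (3 c u)
    from cfun.span_scale[OF this, of c] show ?case by (simp add: mult.assoc)
  qed
  have 1: "(\<lambda>x. u x * exponential b x) \<in> ?V" if u: "u \<in> ?V" and b: "b \<in> S" for u b
  proof -
    have "exponential ` S \<subseteq> {f. (\<lambda>x. f x * exponential b x) \<in> ?V}"
    proof safe
      fix a assume "a \<in> S"
      have "(\<lambda>x. exponential a x * exponential b x) = exponential (a + b)"
        by (auto simp: exponential_def distrib_left distrib_right exp_add)
      then show "(\<lambda>x. exponential a x * exponential b x) \<in> ?V"
        using S[OF \<open>a \<in> S\<close> b] by (auto intro: cfun.span_base)
    qed
    then have "?V \<subseteq> {f. (\<lambda>x. f x * exponential b x) \<in> ?V}" by (rule cfun.span_minimal[OF _ sub])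
    with u show ?thesis by auto
  qed
  have "exponential ` S \<subseteq> {g'. (\<lambda>x. g' x * f x) \<in> ?V}"
    using 1[OF f] by (auto simp: mult.commute)
  then have "?V \<subseteq> {g'. (\<lambda>x. g' x * f x) \<in> ?V}" by (rule cfun.span_minimal[OF _ sub])
  with g show ?thesis by (auto simp: mult.commute)
qed

lemma sin_as_exponentials:
  "(\<lambda>x. of_real (sin (l * x))) = (\<lambda>x. (1 / (2 * \<i>)) * exponential l x) - (\<lambda>x. (1 / (2 * \<i>)) * exponential (-l) x)"
proof
  fix x :: real
  have "complex_of_real (sin (l * x)) = sin (complex_of_real (l * x))" by (rule sin_of_real[symmetric])
  also have "\<dots> = (exp (\<i> * of_real (l * x)) - exp (- (\<i> * of_real (l * x)))) / (2 * \<i>)"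
    by (rule sin_exp_eq)
  finally show "of_real (sin (l * x)) = ((\<lambda>x. (1 / (2 * \<i>)) * exponential l x) - (\<lambda>x. (1 / (2 * \<i>)) * exponential (-l) x)) x"
    by (simp add: exponential_def diff_divide_distrib mult_ac)
qed

text \<open>Stone-Weierstrass for the real functions whose complexification lies in the span.
  Integer frequencies could not give uniform approximation on the closed interval, since their
  exponentials agree at \<open>-pi\<close> and \<open>pi\<close>.\<close>

lemma real_continuous_approx_exponentials:
  fixes u :: "real \<Rightarrow> real"
  assumes u: "continuous_on {-pi..pi} u" and \<epsilon>: "\<epsilon> > 0"
  shows "\<exists>g\<in>cfun.span (exponential ` \<rat>). \<forall>x\<in>{-pi..pi}. cmod (of_real (u x) - g x) < \<epsilon>"
proof -
  let ?V = "cfun.span (exponential ` \<rat>)"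
  define R where "R = {v. continuous_on {-pi..pi} v \<and> (\<lambda>x. complex_of_real (v x)) \<in> ?V}"
  have "function_ring_on R {-pi..pi}"
  proof
    fix f g assume "f \<in> R" "g \<in> R"
    then have fg: "continuous_on {-pi..pi} f" "continuous_on {-pi..pi} g"
      "(\<lambda>x. complex_of_real (f x)) \<in> ?V" "(\<lambda>x. complex_of_real (g x)) \<in> ?V"
      by (auto simp: R_def)
    show "(\<lambda>x. f x + g x) \<in> R"
      using cfun.span_add[OF fg(3,4)] fg by (auto simp: R_def plus_fun_def intro: continuous_intros)
    show "(\<lambda>x. f x * g x) \<in> R"
      using span_exponential_mult[OF _ fg(3,4)] fg by (auto simp: R_def intro: continuous_intros)
  next
    fix c :: real
    have "(\<lambda>x. complex_of_real c * exponential 0 x) \<in> ?V"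
      by (intro cfun.span_scale cfun.span_base) auto
    then show "(\<lambda>_. c) \<in> R" by (auto simp: R_def exponential_def)
  next
    fix x y :: real assume xy: "x \<in> {-pi..pi}" "y \<in> {-pi..pi}" "x \<noteq> y"
    \<comment> \<open>For \<open>x\<close> in \<open>{-pi..pi}\<close>, \<open>1/2 * x\<close> lies
      in \<open>{-pi/2..pi/2}\<close>, where the sine is injective: a single function separates all
      points, endpoints included.\<close>
    have "(\<lambda>x. of_real (sin (1/2 * x))) \<in> ?V"
      unfolding sin_as_exponentials
      by (intro cfun.span_diff cfun.span_scale cfun.span_base) auto
    then have "(\<lambda>x. sin (1/2 * x)) \<in> R" by (simp add: R_def continuous_intros)
    moreover have "sin (1/2 * x) \<noteq> sin (1/2 * y)"
      using xy sin_inj_pi[of "1/2 * x" "1/2 * y"] by auto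
    ultimately show "\<exists>f\<in>R. f x \<noteq> f y" by (intro bexI[of _ "\<lambda>x. sin (1/2 * x)"])
  next
    show "continuous_on {-pi..pi} f" if "f \<in> R" for f using that by (simp add: R_def)
  qed simp
  then interpret function_ring_on R "{-pi..pi}" .
  obtain g where g: "g \<in> R" "\<forall>x\<in>{-pi..pi}. \<bar>u x - g x\<bar> < \<epsilon>"
    using Stone_Weierstrass_basic[OF u \<epsilon>] by blast
  have "cmod (of_real (u x) - of_real (g x)) = \<bar>u x - g x\<bar>" for x
    by (metis norm_of_real of_real_diff real_norm_def)
  with g show ?thesis
    by (intro bexI[of _ "\<lambda>x. of_real (g x)"]) (simp_all add: R_def)
qed

lemma continuous_in_closure_exponentials:
  fixes f :: "real \<Rightarrow> complex"
  assumes f: "continuous_on {-pi..pi} f"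
  shows "f \<in> L2_closure (lebesgue_on {-pi..pi}) (cfun.span (exponential ` \<rat>))" (is "_ \<in> L2_closure ?N ?V")
proof (rule L2_closureI[OF continuous_in_L2_space[OF f]])
  fix \<epsilon> :: real assume \<epsilon>: "\<epsilon> > 0"
  \<comment> \<open>The real and imaginary parts together contribute at most
    \<open>2 * \<delta>\<close> pointwise, so the squared error integrates to at most
    \<open>2 * pi * (4 * \<delta>\<^sup>2) = \<epsilon> / 2\<close>.\<close>
  define \<delta> where "\<delta> = sqrt (\<epsilon> / (16 * pi))"
  have \<delta>: "\<delta> > 0" "\<delta>\<^sup>2 = \<epsilon> / (16 * pi)" using \<epsilon> by (auto simp: \<delta>_def)
  obtain g where g: "g \<in> ?V" "\<And>x. x \<in> {-pi..pi} \<Longrightarrow> cmod (of_real (Re (f x)) - g x) < \<delta>"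
    using real_continuous_approx_exponentials[OF continuous_on_Re[OF f] \<delta>(1)] by blast
  obtain h where h: "h \<in> ?V" "\<And>x. x \<in> {-pi..pi} \<Longrightarrow> cmod (of_real (Im (f x)) - h x) < \<delta>"
    using real_continuous_approx_exponentials[OF continuous_on_Im[OF f] \<delta>(1)] by blast
  define p where "p = g + (\<lambda>x. \<i> * h x)"
  have p: "p \<in> ?V" unfolding p_def by (intro cfun.span_add cfun.span_scale g h)
  have bound: "(cmod (f x - p x))\<^sup>2 \<le> 4 * \<delta>\<^sup>2" if x: "x \<in> {-pi..pi}" for x
  proof -
    have "f x - p x = (of_real (Re (f x)) - g x) + \<i> * (of_real (Im (f x)) - h x)"
      by (subst complex_eq[of "f x"]) (simp add: p_def algebra_simps)
    then have "cmod (f x - p x) \<le> cmod (of_real (Re (f x)) - g x) + cmod (of_real (Im (f x)) - h x)"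
      using norm_triangle_ineq[of "of_real (Re (f x)) - g x" "\<i> * (of_real (Im (f x)) - h x)"]
      by (simp only: norm_mult norm_ii mult_1)
    also have "\<dots> \<le> 2 * \<delta>" using g(2)[OF x] h(2)[OF x] by simp
    finally have "(cmod (f x - p x))\<^sup>2 \<le> (2 * \<delta>)\<^sup>2" by (intro power_mono) auto
    then show ?thesis by (simp add: power_mult_distrib)
  qed
  have "p \<in> L2_space ?N" using p span_subset_L2_space[OF exponential_in_L2_space] by blast
  then have "(\<lambda>x. f x - p x) \<in> L2_space ?N" using L2_space_diff[OF continuous_in_L2_space[OF f]] by simp
  then have "(\<integral>x. (cmod (f x - p x))\<^sup>2 \<partial>?N) \<le> (\<integral>x. 4 * \<delta>\<^sup>2 \<partial>?N)"
    by (intro integral_mono bound integrable_norm_square_L2_space continuous_imp_integrable_real) auto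
  also have "\<dots> = 2 * pi * (4 * \<delta>\<^sup>2)"
    by (simp add: measure_restrict_space)
  also have "\<dots> < \<epsilon>" using \<epsilon> by (simp add: \<delta>(2) field_simps)
  finally show "\<exists>g\<in>?V. (\<integral>x. (cmod (f x - g x))\<^sup>2 \<partial>?N) < \<epsilon>" using p by blast
qed

lemma continuous_on_radial_clip: "B > 0 \<Longrightarrow> continuous_on S (radial_clip B)"
  unfolding radial_clip_def by (intro continuous_intros) auto

lemma norm_radial_clip_le: "B > 0 \<Longrightarrow> cmod (radial_clip B z) \<le> B"
  by (auto simp: radial_clip_def norm_mult norm_divide field_simps max_def)

lemma radial_clip_eq: "B > 0 \<Longrightarrow> cmod z \<le> B \<Longrightarrow> radial_clip B z = z"
  by (simp add: radial_clip_def)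

lemma norm_minus_radial_clip_le: "B > 0 \<Longrightarrow> cmod (z - radial_clip B z) \<le> cmod z"
proof -
  assume B: "B > 0"
  have "z - radial_clip B z = of_real (1 - B / max B (cmod z)) * z"
    by (simp add: radial_clip_def algebra_simps)
  moreover have "0 \<le> B / max B (cmod z)" "B / max B (cmod z) \<le> 1" using B by auto
  then have "\<bar>1 - B / max B (cmod z)\<bar> \<le> 1" by linarith
  ultimately show ?thesis by (simp add: norm_mult mult_left_le_one_le del: of_real_diff)
qed

text \<open>A measurable function is an almost everywhere limit of continuous functions; clipping turns
  this into convergence in \<open>L\<^sup>2\<close>, first for bounded functions and then in general.\<close>
lemma closure_exponentials_eq_L2_space:
  "L2_closure (lebesgue_on {-pi..pi}) (cfun.span (exponential ` \<rat>)) = L2_space (lebesgue_on {-pi..pi})"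
  (is "L2_closure ?N ?V = _")
proof (intro equalityI subsetI)
  have V: "?V \<subseteq> L2_space ?N" by (intro span_subset_L2_space exponential_in_L2_space)
  interpret N: finite_measure ?N
    by standard (simp add: space_restrict_space emeasure_restrict_space)
  \<comment> \<open>Dominated convergence inside a closed set; the two uses below have the majorants
    \<open>(2 * B)\<^sup>2\<close> and \<open>(cmod (f x))\<^sup>2\<close>.\<close>
  have L2_lim: "f \<in> L2_closure ?N ?V"
    if f: "f \<in> L2_space ?N" and s: "\<And>n. s n \<in> L2_closure ?N ?V"
      and lim: "AE x in ?N. (\<lambda>n. s n x) \<longlonglongrightarrow> f x"
      and w: "integrable ?N w" "\<And>n. AE x in ?N. (cmod (f x - s n x))\<^sup>2 \<le> w x"
    for f s and w :: "real \<Rightarrow> real"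
  proof (rule L2_closure_idem[OF f V])
    fix \<epsilon> :: real assume \<epsilon>: "\<epsilon> > 0"
    have [measurable]: "f \<in> borel_measurable ?N" "s n \<in> borel_measurable ?N" for n
      using f s[of n] L2_closure_subset_L2_space borel_measurable_L2_space by blast+
    have "(\<lambda>n. \<integral>x. (cmod (f x - s n x))\<^sup>2 \<partial>?N) \<longlonglongrightarrow> (\<integral>x. 0 \<partial>?N)"
    proof (rule integral_dominated_convergence[OF _ _ w(1)])
      show "AE x in ?N. (\<lambda>n. (cmod (f x - s n x))\<^sup>2) \<longlonglongrightarrow> 0"
        using lim
      proof eventually_elim
        case (elim x)
        then have "(\<lambda>n. (cmod (f x - s n x))\<^sup>2) \<longlonglongrightarrow> (cmod (f x - f x))\<^sup>2" by (intro tendsto_intros)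
        then show ?case by simp
      qed
    qed (use w in auto)
    then have "eventually (\<lambda>n. (\<integral>x. (cmod (f x - s n x))\<^sup>2 \<partial>?N) < \<epsilon>) sequentially"
      using \<epsilon> by (intro order_tendstoD(2)) auto
    then obtain n where "(\<integral>x. (cmod (f x - s n x))\<^sup>2 \<partial>?N) < \<epsilon>"
      by (auto simp: eventually_sequentially)
    then show "\<exists>g\<in>L2_closure ?N ?V. (\<integral>x. (cmod (f x - g x))\<^sup>2 \<partial>?N) < \<epsilon>" using s by blast
  qed
  have clip_L2: "(\<lambda>x. radial_clip B (f x)) \<in> L2_space ?N"
    if B: "B > 0" and f: "f \<in> borel_measurable ?N" for B f
  proof -
    have [measurable]: "(\<lambda>x. radial_clip B (f x)) \<in> borel_measurable ?N"
      by (rule borel_measurable_continuous_on[OF continuous_on_radial_clip[OF B] f])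
    have "integrable ?N (\<lambda>x. (cmod (radial_clip B (f x)))\<^sup>2)"
      using norm_radial_clip_le[OF B]
      by (intro N.integrable_const_bound[of _ "B\<^sup>2"] AE_I2) (auto intro!: power_mono)
    then show ?thesis by (simp add: L2_space_def)
  qed
  have clip: "(\<lambda>x. radial_clip B (f x)) \<in> L2_closure ?N ?V"
    if B: "B > 0" and f: "f \<in> borel_measurable ?N" for B f
  proof -
    from f have "f measurable_on {-pi..pi}" by (subst measurable_on_iff_borel_measurable) auto
    then obtain M g where M: "negligible M" and g: "\<And>n. continuous_on UNIV (g n)"
      "\<And>x. x \<notin> M \<Longrightarrow> (\<lambda>n. g n x) \<longlonglongrightarrow> (if x \<in> {-pi..pi} then f x else 0)"
      unfolding measurable_on_def by blast
    show ?thesis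
    proof (rule L2_lim)
      show "(\<lambda>x. radial_clip B (f x)) \<in> L2_space ?N" by (rule clip_L2[OF B f])
      show "(\<lambda>x. radial_clip B (g n x)) \<in> L2_closure ?N ?V" for n
        by (intro continuous_in_closure_exponentials continuous_on_compose2[OF continuous_on_radial_clip[OF B, of UNIV]]
            continuous_on_subset[OF g(1)]) auto
      have "AE x in ?N. x \<in> {-pi..pi} \<and> x \<notin> M"
        using M by (subst AE_restrict_space_iff)
          (auto simp: negligible_iff_null_sets intro: AE_not_in[THEN eventually_mono])
      then show "AE x in ?N. (\<lambda>n. radial_clip B (g n x)) \<longlonglongrightarrow> radial_clip B (f x)"
      proof eventually_elim
        case (elim x)
        then have "(\<lambda>n. g n x) \<longlonglongrightarrow> f x" using g(2)[of x] by auto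
        then show ?case
          using continuous_on_radial_clip[OF B, of UNIV] by (intro continuous_on_tendsto_compose[of UNIV "radial_clip B"]) auto
      qed
      show "integrable ?N (\<lambda>_. (2 * B)\<^sup>2)" by simp
      show "AE x in ?N. (cmod (radial_clip B (f x) - radial_clip B (g n x)))\<^sup>2 \<le> (2 * B)\<^sup>2" for n
      proof (intro AE_I2 power_mono)
        fix x
        show "cmod (radial_clip B (f x) - radial_clip B (g n x)) \<le> 2 * B"
          using norm_triangle_ineq4[of "radial_clip B (f x)" "radial_clip B (g n x)"]
            norm_radial_clip_le[OF B, of "f x"] norm_radial_clip_le[OF B, of "g n x"] by linarith
      qed auto
    qed
  qed
  fix f assume f: "f \<in> L2_space ?N"
  show "f \<in> L2_closure ?N ?V"
  proof (rule L2_lim[OF f])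
    show "(\<lambda>x. radial_clip (real (Suc n)) (f x)) \<in> L2_closure ?N ?V" for n
      using f by (intro clip borel_measurable_L2_space) auto
    show "integrable ?N (\<lambda>x. (cmod (f x))\<^sup>2)" using f by (rule integrable_norm_square_L2_space)
    show "AE x in ?N. (cmod (f x - radial_clip (real (Suc n)) (f x)))\<^sup>2 \<le> (cmod (f x))\<^sup>2" for n
      by (intro AE_I2 power_mono norm_minus_radial_clip_le) auto
    show "AE x in ?N. (\<lambda>n. radial_clip (real (Suc n)) (f x)) \<longlonglongrightarrow> f x"
    proof (intro AE_I2 tendsto_eventually)
      fix x
      obtain m :: nat where m: "cmod (f x) \<le> real m" using real_arch_simple by blast
      then show "eventually (\<lambda>n. radial_clip (real (Suc n)) (f x) = f x) sequentially"
        by (intro eventually_sequentiallyI[of m] radial_clip_eq) auto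
    qed
  qed
qed (use L2_closure_subset_L2_space in auto)

lemma spans_L2_exponentialI:
  assumes "\<And>q. q \<in> \<rat> \<Longrightarrow>
    exponential q \<in> L2_closure (lebesgue_on {-pi..pi}) (cfun.span (exponential ` S))"
  shows "spans_L2 (lebesgue_on {-pi..pi}) (exponential ` S)"
proof -
  let ?N = "lebesgue_on {-pi..pi}" and ?V = "cfun.span (exponential ` S)"
  have V: "?V \<subseteq> L2_space ?N" by (intro span_subset_L2_space exponential_in_L2_space)
  have "cfun.span (exponential ` \<rat>) \<subseteq> L2_closure ?N ?V"
    using assms by (intro cfun.span_minimal subspace_L2_closure V cfun.subspace_span) auto
  moreover have "\<exists>g\<in>cfun.span (exponential ` \<rat>). (\<integral>x. (cmod (f x - g x))\<^sup>2 \<partial>?N) < \<epsilon>"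
    if "f \<in> L2_space ?N" "\<epsilon> > 0" for f \<epsilon>
    using that L2_closureD[of f ?N "cfun.span (exponential ` \<rat>)" \<epsilon>] closure_exponentials_eq_L2_space by blast
  ultimately have "f \<in> L2_closure ?N ?V" if "f \<in> L2_space ?N" for f
    using that by (intro L2_closure_idem[OF that V]) blast
  then show ?thesis
    using L2_closure_subset_L2_space exponential_in_L2_space unfolding spans_L2_def by blast
qed

subsection \<open>Fourier transforms of functions on an interval\<close>

text \<open>An exponential minus an element of the span is thus continuous, which makes its Fourier
  integral a Henstock-Kurzweil integral that can be differentiated under the integral sign.\<close>

lemma continuous_on_span_exponential:
  assumes "g \<in> cfun.span (exponential ` S)"
  shows "continuous_on UNIV g"
proof -
  have "cfun.subspace {f. continuous_on UNIV f}"
    unfolding cfun.subspace_def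
    by (auto simp: plus_fun_def zero_fun_def intro!: continuous_intros)
  then have "cfun.span (exponential ` S) \<subseteq> {f. continuous_on UNIV f}"
    by (intro cfun.span_minimal) (auto intro: continuous_on_exponential)
  then show ?thesis using assms by auto
qed

text \<open>Two bounds are merged: \<open>I \<le> 8 * E\<close> from the length
  \<open>2 * pi\<close> and the maximum of the integrand, and
  \<open>2 * (\<bar>y\<bar> * I) \<le> E\<close> from the explicit primitive. Together they bound
  \<open>(1 + \<bar>y\<bar>) * I\<close> by \<open>9 * E\<close>. The denominator is the source of
  the logarithmic gain.\<close>

lemma integral_exp_le:
  fixes y :: real
  shows "(\<integral>x. exp (2 * y * x) \<partial>lebesgue_on {-pi..pi}) \<le> 9 * (exp (2 * pi * \<bar>y\<bar>) / (1 + \<bar>y\<bar>))"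
proof -
  let ?N = "lebesgue_on {-pi..pi}"
  define I where "I = (\<integral>x. exp (2 * y * x) \<partial>?N)"
  define E where "E = exp (2 * pi * \<bar>y\<bar>)"
  have int: "integrable ?N (\<lambda>x. exp (2 * y * x))"
    by (intro continuous_imp_integrable_real continuous_intros)
  have le_E: "exp (2 * y * x) \<le> E" if "x \<in> {-pi..pi}" for x
  proof -
    have "y * x \<le> \<bar>y\<bar> * \<bar>x\<bar>" by (metis abs_ge_self abs_mult)
    also have "\<dots> \<le> \<bar>y\<bar> * pi" using that by (intro mult_left_mono) auto
    finally show ?thesis by (simp add: E_def mult_ac)
  qed
  have "I \<le> (\<integral>x. E \<partial>?N)"
    unfolding I_def using le_E by (intro integral_mono int continuous_imp_integrable_real) auto
  also have "\<dots> = 2 * pi * E" by (simp add: measure_restrict_space)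
  also have "\<dots> \<le> 8 * E" using pi_less_4 by (intro mult_right_mono) (auto simp: E_def)
  finally have I: "I \<le> 8 * E" .
  have "I = integral {-pi..pi} (\<lambda>x. exp (2 * y * x))"
    unfolding I_def by (intro lebesgue_integral_eq_integral int) auto
  moreover have "((\<lambda>x. 2 * y * exp (2 * y * x)) has_integral (exp (2 * y * pi) - exp (2 * y * (-pi)))) {-pi..pi}"
    by (intro fundamental_theorem_of_calculus)
      (auto intro!: derivative_eq_intros simp flip: has_real_derivative_iff_has_vector_derivative)
  then have "integral {-pi..pi} (\<lambda>x. 2 * y * exp (2 * y * x)) = exp (2 * y * pi) - exp (2 * y * (-pi))"
    by (rule integral_unique)
  ultimately have yI: "2 * y * I = exp (2 * y * pi) - exp (2 * y * (-pi))" by simp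
  have "0 \<le> I" unfolding I_def by (intro integral_nonneg_AE) auto
  have "2 * (\<bar>y\<bar> * I) = \<bar>2 * y * I\<bar>" using \<open>0 \<le> I\<close> by (simp add: abs_mult)
  also have "\<dots> = \<bar>exp (2 * y * pi) - exp (2 * y * (-pi))\<bar>" by (simp only: yI)
  also have "\<dots> \<le> E"
    using le_E[of pi] le_E[of "-pi"] exp_gt_zero[of "2 * y * pi"] exp_gt_zero[of "2 * y * (-pi)"]
    by (simp add: abs_le_iff del: exp_gt_zero)
  finally have "(1 + \<bar>y\<bar>) * I \<le> 9 * E" using I \<open>0 \<le> I\<close> by (simp add: distrib_right)
  then show ?thesis by (simp add: I_def E_def field_simps)
qed

text \<open>The inequality of arithmetic and geometric means \<open>2ab \<le> ta\<^sup>2 + b\<^sup>2/t\<close>, with the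
  optimal order of magnitude for \<open>t\<close>, replaces the Cauchy-Schwarz inequality.\<close>
lemma norm_Fourier_integral_le:
  fixes h :: "real \<Rightarrow> complex"
  assumes h: "continuous_on UNIV h"
  shows "cmod (\<integral>x. h x * exp (-\<i> * z * of_real x) \<partial>lebesgue_on {-pi..pi}) \<le>
    ((\<integral>x. (cmod (h x))\<^sup>2 \<partial>lebesgue_on {-pi..pi}) + 9) / 2 * exp (pi * \<bar>Im z\<bar>) / sqrt (1 + \<bar>Im z\<bar>)"
    (is "cmod (integral\<^sup>L ?N _) \<le> (?B + 9) / 2 * _ / _")
proof -
  define t where "t = exp (pi * \<bar>Im z\<bar>) / sqrt (1 + \<bar>Im z\<bar>)"
  have t: "t > 0" by (simp add: t_def add_pos_nonneg)
  have t2: "t\<^sup>2 = exp (2 * pi * \<bar>Im z\<bar>) / (1 + \<bar>Im z\<bar>)"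
    by (simp add: t_def power_divide exp_double[symmetric] mult_ac)
  have int: "integrable ?N f" if "continuous_on UNIV f" for f :: "real \<Rightarrow> 'b::euclidean_space"
    using that by (intro continuous_imp_integrable_real) (auto intro: continuous_on_subset)
  have ineq: "cmod (h x * exp (-\<i> * z * of_real x)) \<le> t / 2 * (cmod (h x))\<^sup>2 + 1 / (2 * t) * exp (2 * Im z * x)" for x
  proof -
    define a b where "a = cmod (h x)" and "b = exp (Im z * x)"
    have "0 \<le> (t * a - b)\<^sup>2" by simp
    then have "2 * t * (a * b) \<le> t\<^sup>2 * a\<^sup>2 + b\<^sup>2" by (simp add: power2_diff power_mult_distrib mult_ac)
    then have "a * b \<le> t / 2 * a\<^sup>2 + 1 / (2 * t) * b\<^sup>2"
      using t by (simp add: field_simps power2_eq_square)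
    moreover have "b\<^sup>2 = exp (2 * Im z * x)" by (simp add: b_def exp_double[symmetric] mult_ac)
    ultimately show ?thesis by (simp add: a_def b_def norm_mult norm_exp_eq_Re)
  qed
  have "cmod (\<integral>x. h x * exp (-\<i> * z * of_real x) \<partial>?N) \<le> (\<integral>x. cmod (h x * exp (-\<i> * z * of_real x)) \<partial>?N)"
    by (rule integral_norm_bound)
  also have "\<dots> \<le> (\<integral>x. t / 2 * (cmod (h x))\<^sup>2 + 1 / (2 * t) * exp (2 * Im z * x) \<partial>?N)"
    by (intro integral_mono ineq int continuous_intros h)
  also have "\<dots> = t / 2 * ?B + 1 / (2 * t) * (\<integral>x. exp (2 * Im z * x) \<partial>?N)"
    using t by (subst Bochner_Integration.integral_add) (simp_all add: int continuous_intros h)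
  also have "\<dots> \<le> t / 2 * ?B + 1 / (2 * t) * (9 * t\<^sup>2)"
    using integral_exp_le[of "Im z"] t unfolding t2 by (intro add_left_mono mult_left_mono) auto
  also have "\<dots> = (?B + 9) / 2 * t" using t by (simp add: field_simps power2_eq_square)
  finally show ?thesis by (simp add: t_def)
qed

lemma holomorphic_Fourier_integral:
  fixes h :: "real \<Rightarrow> complex"
  assumes h: "continuous_on UNIV h"
  shows "(\<lambda>z. \<integral>x. h x * exp (-\<i> * z * of_real x) \<partial>lebesgue_on {a..b}) holomorphic_on UNIV"
proof -
  have cont: "continuous_on UNIV (\<lambda>x. h x * exp (-\<i> * z * of_real x))" for z
    by (intro continuous_intros h)
  have "(\<lambda>z. integral (cbox a b) (\<lambda>x. h x * exp (-\<i> * z * of_real x))) holomorphic_on UNIV"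
  proof (rule leibniz_rule_holomorphic)
    show "((\<lambda>z. h x * exp (-\<i> * z * of_real x)) has_field_derivative
        h x * (exp (-\<i> * z * of_real x) * (-\<i> * of_real x))) (at z within UNIV)" for z x
      by (auto intro!: derivative_eq_intros)
    show "(\<lambda>x. h x * exp (-\<i> * z * of_real x)) integrable_on cbox a b" for z
      by (intro integrable_continuous continuous_on_subset[OF cont]) auto
    show "continuous_on (UNIV \<times> cbox a b) (\<lambda>(z, x). h x * (exp (-\<i> * z * of_real x) * (-\<i> * of_real x)))"
      unfolding case_prod_unfold
      by (intro continuous_intros continuous_on_compose2[OF h]) auto
  qed auto
  moreover have "(\<integral>x. h x * exp (-\<i> * z * of_real x) \<partial>lebesgue_on {a..b}) =
      integral (cbox a b) (\<lambda>x. h x * exp (-\<i> * z * of_real x))" for z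
    unfolding box_real
    by (intro lebesgue_integral_eq_integral continuous_imp_integrable_real continuous_on_subset[OF cont]) auto
  ultimately show ?thesis by simp
qed

text \<open>The deterministic half of the theorem. If the exponential had positive distance from the
  span, then for every \<open>R\<close> the residual of its projection onto finitely many
  exponentials would bound the sum by Jensen's inequality, with an additive constant
  \<open>ln C\<close> common to all \<open>R\<close>.\<close>

lemma exponential_in_closureI:
  fixes L :: "real set" and \<mu> :: real
  assumes fin: "\<And>R. finite {l \<in> L. 0 < \<bar>l - \<mu>\<bar> \<and> \<bar>l - \<mu>\<bar> < R}"
    and unbounded: "\<And>C. \<exists>R\<ge>2. C < (\<Sum>l | l \<in> L \<and> 0 < \<bar>l - \<mu>\<bar> \<and> \<bar>l - \<mu>\<bar> < R. ln (R / \<bar>l - \<mu>\<bar>)) - 2 * R + ln (R / 2) / 3"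
  shows "exponential \<mu> \<in> L2_closure (lebesgue_on {-pi..pi}) (cfun.span (exponential ` L))"
    (is "_ \<in> L2_closure ?N ?V")
proof (rule ccontr)
  have V: "?V \<subseteq> L2_space ?N" by (intro span_subset_L2_space exponential_in_L2_space)
  have e: "exponential \<mu> \<in> L2_space ?N" using exponential_in_L2_space[of "{\<mu>}"] by auto
  assume not_in: "exponential \<mu> \<notin> L2_closure ?N ?V"
  have "\<exists>\<epsilon>>0. \<forall>g\<in>?V. \<epsilon> \<le> (\<integral>x. (cmod (exponential \<mu> x - g x))\<^sup>2 \<partial>?N)"
  proof (rule ccontr)
    assume "\<not> ?thesis"
    then have "\<exists>g\<in>?V. (\<integral>x. (cmod (exponential \<mu> x - g x))\<^sup>2 \<partial>?N) < \<epsilon>" if "\<epsilon> > 0" for \<epsilon>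
      using that by (simp add: not_le)
    with not_in show False using L2_closureI[OF e] by blast
  qed
  then obtain \<epsilon> where \<epsilon>: "\<epsilon> > 0" "\<And>g. g \<in> ?V \<Longrightarrow> \<epsilon> \<le> (\<integral>x. (cmod (exponential \<mu> x - g x))\<^sup>2 \<partial>?N)"
    by blast
  \<comment> \<open>With \<open>B\<close> the squared norm of the residual, the growth constant is
    \<open>(B + 9) / 2\<close> and the value at the centre is \<open>B\<close>. Their quotient is at
    most \<open>C\<close> whenever \<open>\<epsilon> \<le> B\<close>, so \<open>C\<close> can be
    fixed before \<open>R\<close>.\<close>
  define C where "C = 1 / 2 + 9 / (2 * \<epsilon>)"
  have C: "C > 0" using \<epsilon> by (simp add: C_def add_pos_pos)
  obtain R where R: "R \<ge> 2" and large: "ln C <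
    (\<Sum>l | l \<in> L \<and> 0 < \<bar>l - \<mu>\<bar> \<and> \<bar>l - \<mu>\<bar> < R. ln (R / \<bar>l - \<mu>\<bar>)) - 2 * R + ln (R / 2) / 3"
    using unbounded by blast
  define L' where "L' = {l \<in> L. 0 < \<bar>l - \<mu>\<bar> \<and> \<bar>l - \<mu>\<bar> < R}"
  have L': "finite L'" "L' \<subseteq> L" using fin by (auto simp: L'_def)
  obtain g where g: "g \<in> cfun.span (exponential ` L')"
    and orth: "\<And>l. l \<in> L' \<Longrightarrow> L2_inner ?N (\<lambda>x. exponential \<mu> x - g x) (exponential l) = 0"
    using finite_orthogonal_projection[OF _ exponential_in_L2_space e, of L'] L' by auto
  define h where "h = (\<lambda>x. exponential \<mu> x - g x)"
  define B where "B = (\<integral>x. (cmod (h x))\<^sup>2 \<partial>?N)"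
  have "g \<in> ?V" using g cfun.span_mono[of "exponential ` L'" "exponential ` L"] L' by auto
  then have B: "B \<ge> \<epsilon>" unfolding B_def h_def by (rule \<epsilon>)
  have gL2: "g \<in> L2_space ?N" using \<open>g \<in> ?V\<close> V by auto
  have hL2: "h \<in> L2_space ?N" unfolding h_def by (intro L2_space_diff e gL2)
  have h: "continuous_on UNIV h"
    unfolding h_def by (intro continuous_intros continuous_on_exponential continuous_on_span_exponential[OF g])
  define F where "F z = (\<integral>x. h x * exp (-\<i> * z * of_real x) \<partial>?N)" for z
  have F_inner: "F (of_real l) = L2_inner ?N h (exponential l)" for l
    by (simp add: F_def L2_inner_def exponential_def exp_cnj)
  define F\<^sub>\<mu> where "F\<^sub>\<mu> z = F (of_real \<mu> + z)" for z
  \<comment> \<open>As \<open>exponential \<mu>\<close> is \<open>h + g\<close> with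
    \<open>h\<close> orthogonal to \<open>g\<close>, the Fourier integral of \<open>h\<close> at
    \<open>\<mu>\<close> is the squared norm of \<open>h\<close>.\<close>
  have "L2_inner ?N h (\<lambda>x. h x + g x) = L2_inner ?N h h + L2_inner ?N h g"
    by (rule L2_inner_add_right[OF hL2 gL2 hL2])
  also have "L2_inner ?N h g = 0"
    using orth by (intro L2_inner_span_eq_0[OF exponential_in_L2_space hL2 _ g]) (auto simp: h_def)
  finally have F0: "F\<^sub>\<mu> 0 = of_real B"
    by (simp add: F\<^sub>\<mu>_def F_inner L2_inner_self B_def h_def)
  define Z where "Z = (\<lambda>l. complex_of_real (l - \<mu>)) ` L'"
  have inj: "inj_on (\<lambda>l. complex_of_real (l - \<mu>)) L'" by (auto simp: inj_on_def)
  have Jensen: "norm (F\<^sub>\<mu> 0) * (\<Prod>l\<in>Z. R / norm l) \<le> ((B + 9) / 2) * exp (2 * R - ln (R / 2) / 3)"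
  proof (rule Jensen_Paley_Wiener[OF _ R])
    have "F holomorphic_on UNIV" unfolding F_def by (rule holomorphic_Fourier_integral[OF h])
    then show "F\<^sub>\<mu> holomorphic_on UNIV"
      using holomorphic_on_compose_gen[of "\<lambda>z. of_real \<mu> + z" UNIV F UNIV]
      by (simp add: F\<^sub>\<mu>_def[abs_def] o_def holomorphic_intros)
    show "Z \<subseteq> ball 0 R - {0}" by (auto simp: Z_def L'_def simp del: of_real_diff)
    show "F\<^sub>\<mu> l = 0" if "l \<in> Z" for l
      using that orth by (auto simp: Z_def F\<^sub>\<mu>_def F_inner h_def)
    show "cmod (F\<^sub>\<mu> z) \<le> (B + 9) / 2 * exp (pi * \<bar>Im z\<bar>) / sqrt (1 + \<bar>Im z\<bar>)" for z
      using norm_Fourier_integral_le[OF h, of "of_real \<mu> + z"] by (simp add: F\<^sub>\<mu>_def F_def B_def)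
  qed (use L' B \<epsilon> in \<open>auto simp: Z_def\<close>)
  have prod_Z: "(\<Prod>l\<in>Z. R / norm l) = exp (\<Sum>l\<in>L'. ln (R / \<bar>l - \<mu>\<bar>))"
  proof -
    have "(\<Prod>l\<in>Z. R / norm l) = (\<Prod>l\<in>L'. R / \<bar>l - \<mu>\<bar>)"
      unfolding Z_def prod.reindex[OF inj] o_def norm_of_real ..
    also have "\<dots> = (\<Prod>l\<in>L'. exp (ln (R / \<bar>l - \<mu>\<bar>)))"
      using R by (intro prod.cong) (auto simp: L'_def)
    also have "\<dots> = exp (\<Sum>l\<in>L'. ln (R / \<bar>l - \<mu>\<bar>))" using L' by (simp add: exp_sum)
    finally show ?thesis .
  qed
  have "norm (F\<^sub>\<mu> 0) = B" using B \<epsilon> by (simp add: F0)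
  with Jensen prod_Z have "B * exp (\<Sum>l\<in>L'. ln (R / \<bar>l - \<mu>\<bar>)) \<le> ((B + 9) / 2) * exp (2 * R - ln (R / 2) / 3)"
    by (simp only:)
  also have "(B + 9) / 2 \<le> B * C"
    using B \<epsilon> by (simp add: C_def field_simps)
  finally have "B * exp (\<Sum>l\<in>L'. ln (R / \<bar>l - \<mu>\<bar>)) \<le> B * (C * exp (2 * R - ln (R / 2) / 3))"
    by (simp add: mult.assoc mult_right_mono)
  moreover have "B > 0" using B \<epsilon> by simp
  ultimately have "exp (\<Sum>l\<in>L'. ln (R / \<bar>l - \<mu>\<bar>)) \<le> C * exp (2 * R - ln (R / 2) / 3)"
    by (simp only: mult_le_cancel_left_pos)
  also have "\<dots> = exp (ln C + (2 * R - ln (R / 2) / 3))" using C by (simp add: exp_add)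
  finally have "(\<Sum>l\<in>L'. ln (R / \<bar>l - \<mu>\<bar>)) \<le> ln C + (2 * R - ln (R / 2) / 3)" by (simp only: exp_le_cancel_iff)
  with large show False unfolding L'_def by linarith
qed

subsection \<open>Linear statistics of the sine process\<close>

text \<open>The square of the sine kernel as a function of the difference of its arguments; the
  two-point intensity is 1 minus this.\<close>

definition sinc_square :: "real \<Rightarrow> real"
  where "sinc_square u = (if u = 0 then 1 else (sin (pi * u) / (pi * u))\<^sup>2)"

section \<open>Counting points and pairs of points\<close>

lemma num_points_image: "inj_on f A \<Longrightarrow> num_points (f ` A) = num_points A"
  by (auto simp: num_points_def emeasure_count_space card_image dest: finite_imageD)

lemma num_points_Times: "num_points (A \<times> B) = num_points A * num_points B"
proof -
  have top: "\<infinity> * num_points S = (if S = {} then 0 else \<infinity>)" for S :: "'c set"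
    by (auto simp: num_points_def emeasure_count_space ennreal_top_mult)
  consider "finite A" "finite B" | "A = {} \<or> B = {}" | "A \<noteq> {}" "B \<noteq> {}" "infinite A \<or> infinite B" by blast
  then show ?thesis
  proof cases
    case 1
    then show ?thesis by (simp add: num_points_def emeasure_count_space card_cartesian_product)
  next
    case 2
    then show ?thesis by (auto simp: num_points_def)
  next
    case 3
    then have "infinite (A \<times> B)" by (auto simp: finite_cartesian_product_iff)
    moreover have "num_points A = \<infinity> \<or> num_points B = \<infinity>"
      using 3 by (auto simp: num_points_def emeasure_count_space)
    ultimately show ?thesis
      using 3 top[of A] top[of B] by (auto simp: num_points_def emeasure_count_space mult.commute)
  qed
qed

lemma num_points_distinct_tuples_1:
  fixes S A :: "'a set"
  shows "num_points (distinct_tuples 1 S \<inter> (\<Pi>\<^sub>E i\<in>{..<1}. A)) = num_points (S \<inter> A)"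
proof -
  let ?f = "\<lambda>a. \<lambda>i\<in>{..<1::nat}. a"
  have "?f ` (S \<inter> A) = distinct_tuples 1 S \<inter> (\<Pi>\<^sub>E i\<in>{..<1}. A)"
  proof (intro equalityI subsetI)
    fix x assume x: "x \<in> distinct_tuples 1 S \<inter> (\<Pi>\<^sub>E i\<in>{..<1}. A)"
    then have x': "x \<in> {..<1} \<rightarrow>\<^sub>E S" "x \<in> {..<1} \<rightarrow>\<^sub>E A" by (simp_all add: distinct_tuples_def)
    have "x 0 \<in> S \<inter> A" using PiE_mem[OF x'(1), of 0] PiE_mem[OF x'(2), of 0] by simp
    moreover have "x = ?f (x 0)"
    proof
      fix i show "x i = ?f (x 0) i" using PiE_arb[OF x'(1), of i] by (cases i) simp_all
    qed
    ultimately show "x \<in> ?f ` (S \<inter> A)" by (rule rev_image_eqI)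
  next
    fix x assume "x \<in> ?f ` (S \<inter> A)"
    then obtain a where a: "a \<in> S" "a \<in> A" and x: "x = ?f a" by blast
    have "x \<in> {..<1} \<rightarrow>\<^sub>E S" "x \<in> {..<1} \<rightarrow>\<^sub>E A" "inj_on x {..<1}"
      using a unfolding x by (simp_all add: restrict_PiE_iff inj_on_def)
    then show "x \<in> distinct_tuples 1 S \<inter> (\<Pi>\<^sub>E i\<in>{..<1}. A)"
      unfolding distinct_tuples_def by blast
  qed
  moreover have "inj_on ?f (S \<inter> A)"
  proof (rule inj_onI)
    fix a b assume ab: "?f a = ?f b"
    show "a = b" using fun_cong[OF ab, of 0] by simp
  qed
  ultimately show ?thesis using num_points_image[of ?f "S \<inter> A"] by simp
qed

lemma num_points_distinct_tuples_2:
  fixes S A B :: "'a set"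
  shows "num_points (distinct_tuples 2 S \<inter> (\<Pi>\<^sub>E i\<in>{..<2}. if i = 0 then A else B)) =
    num_points {p \<in> (S \<inter> A) \<times> (S \<inter> B). fst p \<noteq> snd p}"
proof -
  let ?f = "\<lambda>p. \<lambda>i\<in>{..<2::nat}. if i = 0 then fst p else snd p"
  let ?P = "{p \<in> (S \<inter> A) \<times> (S \<inter> B). fst p \<noteq> snd p}"
  have "?f ` ?P = distinct_tuples 2 S \<inter> (\<Pi>\<^sub>E i\<in>{..<2}. if i = 0 then A else B)"
  proof (intro equalityI subsetI)
    fix x assume x: "x \<in> distinct_tuples 2 S \<inter> (\<Pi>\<^sub>E i\<in>{..<2}. if i = 0 then A else B)"
    then have ext: "x \<in> extensional {..<2}" by (auto simp: PiE_def)
    have x_eq: "x = ?f (x 0, x 1)"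
    proof
      fix i show "x i = ?f (x 0, x 1) i"
      proof (cases "i < 2")
        case True
        then have "i = 0 \<or> i = 1" by auto
        then show ?thesis by auto
      next
        case False
        with ext show ?thesis by (simp add: extensional_def)
      qed
    qed
    have x': "x \<in> {..<2} \<rightarrow>\<^sub>E S" "inj_on x {..<2}" "x \<in> (\<Pi>\<^sub>E i\<in>{..<2}. if i = 0 then A else B)"
      using x by (simp_all add: distinct_tuples_def)
    have "x 0 \<in> A" "x 1 \<in> B" using PiE_mem[OF x'(3), of 0] PiE_mem[OF x'(3), of 1] by simp_all
    moreover have "x 0 \<in> S" "x 1 \<in> S" using PiE_mem[OF x'(1), of 0] PiE_mem[OF x'(1), of 1] by simp_all
    moreover have "x 0 \<noteq> x 1" using inj_onD[OF x'(2), of 0 1] by auto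
    ultimately have "(x 0, x 1) \<in> ?P" by simp
    then show "x \<in> ?f ` ?P" using x_eq by (rule rev_image_eqI)
  next
    fix x assume "x \<in> ?f ` ?P"
    then obtain p where p: "p \<in> ?P" and x: "x = ?f p" by blast
    have "x \<in> {..<2} \<rightarrow>\<^sub>E S" "x \<in> (\<Pi>\<^sub>E i\<in>{..<2}. if i = 0 then A else B)"
      using p unfolding x restrict_PiE_iff by (simp_all add: mem_Times_iff)
    moreover have "inj_on x {..<2}"
    proof (rule inj_onI)
      fix i j assume ij: "i \<in> {..<2}" "j \<in> {..<2}" "x i = x j"
      then have "(if i = 0 then fst p else snd p) = (if j = 0 then fst p else snd p)"
        unfolding x by (simp only: restrict_apply' if_True)
      with p have "i = 0 \<longleftrightarrow> j = 0" by (simp split: if_splits)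
      with ij show "i = j" by (auto dest!: less_2_cases)
    qed
    ultimately show "x \<in> distinct_tuples 2 S \<inter> (\<Pi>\<^sub>E i\<in>{..<2}. if i = 0 then A else B)"
      unfolding distinct_tuples_def by blast
  qed
  moreover have "inj_on ?f ?P"
  proof (rule inj_onI)
    fix p q assume pq: "?f p = ?f q"
    have "fst p = fst q" using fun_cong[OF pq, of 0] by simp
    moreover have "snd p = snd q" using fun_cong[OF pq, of 1] by simp
    ultimately show "p = q" by (simp add: prod_eq_iff)
  qed
  ultimately show ?thesis using num_points_image[of ?f ?P] by simp
qed

text \<open>Intensities count tuples of distinct points, whereas a product of two counts also
  contains the pairs on the diagonal, one for each point of \<open>S \<inter> T\<close>.\<close>

lemma num_points_distinct_pairs_add_diagonal:
  "num_points {p \<in> S \<times> T. fst p \<noteq> snd p} + num_points (S \<inter> T) = num_points S * num_points T"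
proof -
  let ?P = "{p \<in> S \<times> T. fst p \<noteq> snd p}" and ?D = "(\<lambda>a. (a, a)) ` (S \<inter> T)"
  have "num_points (S \<inter> T) = num_points ?D"
    by (intro num_points_image[symmetric]) (simp add: inj_on_def)
  moreover have "num_points ?P + num_points ?D = num_points (?P \<union> ?D)"
    unfolding num_points_def by (intro plus_emeasure) auto
  moreover have "?P \<union> ?D = S \<times> T" by auto
  ultimately show ?thesis by (simp add: num_points_Times)
qed

text \<open>Expressing the count through single-set counts gives its measurability for the traces of
  a point process on Borel sets. Removing the diagonal by cancellation requires a finite diagonal,
  hence the case distinction.\<close>

lemma num_points_distinct_pairs:
  "num_points {p \<in> S \<times> T. fst p \<noteq> snd p} =
    (if num_points (S \<inter> T) = \<infinity> then \<infinity> else num_points S * num_points T - num_points (S \<inter> T))"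
proof (cases "num_points (S \<inter> T) = \<infinity>")
  case True
  then have inf: "infinite (S \<inter> T)" by (auto simp: num_points_def emeasure_count_space split: if_splits)
  then have "S \<inter> T \<noteq> {}" by auto
  then obtain a where a: "a \<in> S \<inter> T" by blast
  have "infinite (Pair a ` (S \<inter> T - {a}))"
    using inf by (subst finite_image_iff) (auto simp: inj_on_def)
  moreover have "Pair a ` (S \<inter> T - {a}) \<subseteq> {p \<in> S \<times> T. fst p \<noteq> snd p}" using a by auto
  ultimately have "infinite {p \<in> S \<times> T. fst p \<noteq> snd p}" using finite_subset by blast
  then have "num_points {p \<in> S \<times> T. fst p \<noteq> snd p} = \<infinity>"
    by (simp add: num_points_def emeasure_count_space)
  with True show ?thesis by (simp only: if_True simp_thms)
next
  case False
  then have "num_points {p \<in> S \<times> T. fst p \<noteq> snd p} =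
      num_points {p \<in> S \<times> T. fst p \<noteq> snd p} + num_points (S \<inter> T) - num_points (S \<inter> T)"
    by (intro ennreal_add_diff_cancel_right[symmetric]) simp
  with False show ?thesis by (simp only: num_points_distinct_pairs_add_diagonal if_False)
qed

lemma measurable_sinc_square [measurable]: "sinc_square \<in> borel_measurable borel"
  unfolding sinc_square_def by measurable

lemma sinc_square_nonneg: "0 \<le> sinc_square u"
  by (simp add: sinc_square_def)

lemma sinc_square_le_1: "sinc_square u \<le> 1"
proof -
  have "(sin (pi * u))\<^sup>2 \<le> (pi * u)\<^sup>2"
    using abs_sin_x_le_abs_x[of "pi * u"] by (simp only: abs_le_square_iff)
  then show ?thesis
    by (auto simp: sinc_square_def power_divide intro: divide_le_eq_1[THEN iffD2])
qed

lemma sinc_square_minus: "sinc_square (- u) = sinc_square u"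
  by (simp add: sinc_square_def)

lemma sine_kernel_mult_swap: "sine_kernel x y * sine_kernel y x = of_real (sinc_square (x - y))"
proof (cases "x = y")
  case False
  have "sin (pi * (y - x)) / (pi * (y - x)) = sin (pi * (x - y)) / (pi * (x - y))"
    using minus_diff_eq[of x y] by (metis minus_divide_divide mult_minus_right sin_minus)
  with False have "sine_kernel y x = of_real (sin (pi * (x - y)) / (pi * (x - y)))"
    unfolding sine_kernel_def using False by (metis (full_types))
  with False show ?thesis
    unfolding sine_kernel_def sinc_square_def power2_eq_square of_real_mult by simp
qed (simp add: sine_kernel_def sinc_square_def)

lemma sine_process_point_process: "sine_process M X \<Longrightarrow> point_process M X"
  by (simp add: sine_process_def determinantal_process_def)

lemma sine_process_intensityE:
  assumes "sine_process M X" "1 \<le> n"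
  obtains \<rho> where "intensity_function M X lborel n \<rho>"
    "\<And>x. x \<in> space (\<Pi>\<^sub>M i\<in>{..<n}. lborel) \<Longrightarrow>
      complex_of_real (\<rho> x) = Determinant.det (Matrix.mat n n (\<lambda>(i, j). sine_kernel (x i) (x j)))"
  using assms unfolding sine_process_def determinantal_process_def by blast

lemma sine_process_mean:
  assumes X: "sine_process M X" and A: "A \<in> sets borel"
  shows "(\<integral>\<^sup>+\<omega>. num_points (X \<omega> \<inter> A) \<partial>M) = emeasure lborel A"
proof -
  interpret product_sigma_finite "\<lambda>_::nat. lborel :: real measure" by standard
  let ?P = "\<Pi>\<^sub>M i\<in>{..<1::nat}. (lborel :: real measure)"
  let ?B = "\<Pi>\<^sub>E i\<in>{..<1::nat}. A"
  obtain \<rho> where \<rho>: "intensity_function M X lborel 1 \<rho>"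
    "\<And>x. x \<in> space ?P \<Longrightarrow>
      complex_of_real (\<rho> x) = Determinant.det (Matrix.mat 1 1 (\<lambda>(i, j). sine_kernel (x i) (x j)))"
    using sine_process_intensityE[OF X order_refl] by blast
  have B: "?B \<in> sets ?P" using A by (intro sets_PiM_I_finite) auto
  have "\<rho> x = 1" if "x \<in> space ?P" for x
    using \<rho>(2)[OF that] by (subst (asm) det_single) (auto simp: sine_kernel_def)
  then have int_\<rho>: "(\<integral>\<^sup>+x\<in>?B. ennreal (\<rho> x) \<partial>?P) = (\<integral>\<^sup>+x. indicator ?B x \<partial>?P)"
    by (intro nn_integral_cong) simp
  have "(\<integral>\<^sup>+\<omega>. num_points (distinct_tuples 1 (X \<omega>) \<inter> ?B) \<partial>M) = (\<integral>\<^sup>+x\<in>?B. ennreal (\<rho> x) \<partial>?P)"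
    using \<rho>(1) B unfolding intensity_function_def by blast
  also have "\<dots> = emeasure ?P ?B" unfolding int_\<rho> using B by simp
  also have "\<dots> = emeasure lborel A" using A by (subst emeasure_PiM) auto
  finally show ?thesis by (simp only: num_points_distinct_tuples_1)
qed

lemma det_mat_2:
  fixes f :: "nat \<times> nat \<Rightarrow> 'a::comm_ring_1"
  shows "Determinant.det (Matrix.mat 2 2 f) = f (0, 0) * f (1, 1) - f (0, 1) * f (1, 0)"
proof -
  let ?A = "Matrix.mat 2 2 f"
  have "Determinant.det ?A = (\<Sum>j<2. ?A $$ (0, j) * cofactor ?A 0 j)"
    by (rule laplace_expansion_row) auto
  moreover have "cofactor ?A 0 j = (if j = 0 then f (1, 1) else - f (1, 0))" if "j < 2" for j
  proof -
    have "Determinant.det (mat_delete ?A 0 j) = mat_delete ?A 0 j $$ (0, 0)"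
      by (rule det_single) (simp add: mat_delete_def)
    then show ?thesis using that by (cases j) (auto simp: cofactor_def mat_delete_def)
  qed
  then have "(\<Sum>j<2. ?A $$ (0, j) * cofactor ?A 0 j) = f (0, 0) * f (1, 1) - f (0, 1) * f (1, 0)"
    by (simp add: numeral_2_eq_2)
  ultimately show ?thesis by (simp only:)
qed

text \<open>The 2 by 2 determinant is
  \<open>K(x,x) K(y,y) - K(x,y) K(y,x) = 1 - sinc_square (x - y)\<close>; Tonelli turns the integral
  over the box of 2-tuples into an iterated one.\<close>

lemma sine_process_distinct_pairs:
  assumes X: "sine_process M X" and [measurable]: "A \<in> sets borel" "B \<in> sets borel"
  shows "(\<integral>\<^sup>+\<omega>. num_points (distinct_tuples 2 (X \<omega>) \<inter> (\<Pi>\<^sub>E i\<in>{..<2}. if i = 0 then A else B)) \<partial>M) =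
    (\<integral>\<^sup>+x. indicator A x * (\<integral>\<^sup>+y. indicator B y * ennreal (1 - sinc_square (x - y)) \<partial>lborel) \<partial>lborel)"
proof -
  interpret product_sigma_finite "\<lambda>_::nat. lborel :: real measure" by standard
  let ?P = "\<Pi>\<^sub>M i\<in>{..<2::nat}. (lborel :: real measure)"
  let ?B = "\<Pi>\<^sub>E i\<in>{..<2::nat}. if i = 0 then A else B"
  have lt2: "{..<2::nat} = {0, 1}" by auto
  obtain \<rho> where \<rho>: "intensity_function M X lborel 2 \<rho>"
    "\<And>x. x \<in> space ?P \<Longrightarrow>
      complex_of_real (\<rho> x) = Determinant.det (Matrix.mat 2 2 (\<lambda>(i, j). sine_kernel (x i) (x j)))"
    using sine_process_intensityE[OF X one_le_numeral] by blast
  have B: "?B \<in> sets ?P" by (intro sets_PiM_I_finite) auto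
  define f where "f x y = indicator A x * (indicator B y * ennreal (1 - sinc_square (x - y)))" for x y
  have f: "case_prod f \<in> borel_measurable (lborel \<Otimes>\<^sub>M lborel)"
    unfolding f_def by measurable
  have \<rho>_eq: "\<rho> x = 1 - sinc_square (x 0 - x 1)" if "x \<in> space ?P" for x
  proof -
    have "complex_of_real (\<rho> x) = 1 - sine_kernel (x 0) (x 1) * sine_kernel (x 1) (x 0)"
      using \<rho>(2)[OF that] by (simp add: det_mat_2 sine_kernel_def[of z z for z])
    then have "complex_of_real (\<rho> x) = complex_of_real (1 - sinc_square (x 0 - x 1))"
      by (simp add: sine_kernel_mult_swap)
    then show ?thesis by (simp only: of_real_eq_iff)
  qed
  have "(\<integral>\<^sup>+\<omega>. num_points (distinct_tuples 2 (X \<omega>) \<inter> ?B) \<partial>M) = (\<integral>\<^sup>+x\<in>?B. ennreal (\<rho> x) \<partial>?P)"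
    using \<rho>(1) B unfolding intensity_function_def by blast
  also have "(\<integral>\<^sup>+x\<in>?B. ennreal (\<rho> x) \<partial>?P) = (\<integral>\<^sup>+x. f (x 0) (x 1) \<partial>?P)"
  proof (intro nn_integral_cong)
    fix x assume x: "x \<in> space ?P"
    then have "x \<in> ?B \<longleftrightarrow> x 0 \<in> A \<and> x 1 \<in> B"
      by (auto simp: space_PiM lt2 PiE_def Pi_def)
    then show "ennreal (\<rho> x) * indicator ?B x = f (x 0) (x 1)"
      using \<rho>_eq[OF x] by (auto simp: f_def indicator_def)
  qed
  also have "\<dots> = (\<integral>\<^sup>+z. f (fst z) (snd z) \<partial>(lborel \<Otimes>\<^sub>M lborel))"
    unfolding lt2 by (intro product_nn_integral_pair f) simp
  also have "\<dots> = (\<integral>\<^sup>+x. \<integral>\<^sup>+y. f x y \<partial>lborel \<partial>lborel)"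
    using lborel.nn_integral_fst[OF f] by (simp add: case_prod_unfold)
  also have "\<dots> = (\<integral>\<^sup>+x. indicator A x * (\<integral>\<^sup>+y. indicator B y * ennreal (1 - sinc_square (x - y)) \<partial>lborel) \<partial>lborel)"
    unfolding f_def by (intro nn_integral_cong nn_integral_cmult) measurable
  finally show ?thesis .
qed

section \<open>From counts of sets to sums over points\<close>

lemma nn_integral_indicator_count_space:
  "(\<integral>\<^sup>+x. indicator A x \<partial>count_space S) = num_points (S \<inter> A)"
proof -
  have "(\<integral>\<^sup>+x. indicator A x \<partial>count_space S) = (\<integral>\<^sup>+x. indicator A x * indicator S x \<partial>count_space UNIV)"
    by (simp add: nn_integral_restrict_space[symmetric] restrict_count_space)
  also have "\<dots> = (\<integral>\<^sup>+x. indicator (S \<inter> A) x \<partial>count_space UNIV)"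
    by (intro nn_integral_cong) (auto simp: indicator_def)
  finally show ?thesis by (simp add: num_points_def)
qed

lemma measurable_linear_statistic:
  assumes X: "point_process M X" and f: "f \<in> borel_measurable borel"
  shows "(\<lambda>\<omega>. \<integral>\<^sup>+x. f x \<partial>count_space (X \<omega>)) \<in> borel_measurable M"
  using f
proof (induction rule: borel_measurable_induct)
  case (cong f g)
  then have "f = g" by auto
  with cong show ?case by simp
next
  case (set A)
  then show ?case using X by (simp add: nn_integral_indicator_count_space point_process_def)
next
  case (mult u c)
  then show ?case by (simp add: nn_integral_cmult)
next
  case (add u v)
  then show ?case by (simp add: nn_integral_add)
next
  case (seq U)
  have "(\<integral>\<^sup>+x. (SUP i. U i) x \<partial>count_space (X \<omega>)) = (SUP i. \<integral>\<^sup>+x. U i x \<partial>count_space (X \<omega>))" for \<omega>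
    using seq.hyps(3) by (simp add: image_comp nn_integral_monotone_convergence_SUP)
  then show ?case using seq.IH by (simp add: borel_measurable_SUP)
qed

text \<open>The weight \<open>Y\<close> makes it possible to extend the second moments to functions one factor at a time.\<close>
lemma weighted_Campbell:
  assumes X: "point_process M X" and f: "f \<in> borel_measurable borel"
    and Y: "Y \<in> borel_measurable M" and w: "w \<in> borel_measurable borel"
    and base: "\<And>A. A \<in> sets borel \<Longrightarrow>
      (\<integral>\<^sup>+\<omega>. num_points (X \<omega> \<inter> A) * Y \<omega> \<partial>M) = (\<integral>\<^sup>+x. indicator A x * w x \<partial>lborel)"
  shows "(\<integral>\<^sup>+\<omega>. (\<integral>\<^sup>+x. f x \<partial>count_space (X \<omega>)) * Y \<omega> \<partial>M) = (\<integral>\<^sup>+x. f x * w x \<partial>lborel)"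
  using f
proof (induction rule: borel_measurable_induct)
  case (cong f g)
  then have "f = g" by auto
  with cong show ?case by simp
next
  case (set A)
  then show ?case using base by (simp add: nn_integral_indicator_count_space)
next
  case (mult u c)
  note [measurable] = measurable_linear_statistic[OF X mult(2)] Y w mult(2)
  show ?case using mult by (simp add: nn_integral_cmult mult.assoc)
next
  case (add u v)
  note [measurable] = measurable_linear_statistic[OF X add(1)] measurable_linear_statistic[OF X add(3)] Y w add(1,3)
  show ?case using add by (simp add: nn_integral_add distrib_right)
next
  case (seq U)
  note [measurable] = measurable_linear_statistic[OF X seq(1)] Y w seq(1)
  have "(\<integral>\<^sup>+\<omega>. (\<integral>\<^sup>+x. (SUP i. U i) x \<partial>count_space (X \<omega>)) * Y \<omega> \<partial>M)
      = (\<integral>\<^sup>+\<omega>. (SUP i. (\<integral>\<^sup>+x. U i x \<partial>count_space (X \<omega>)) * Y \<omega>) \<partial>M)"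
    using seq.hyps(3) by (simp add: image_comp nn_integral_monotone_convergence_SUP SUP_mult_right_ennreal)
  also have "\<dots> = (SUP i. \<integral>\<^sup>+\<omega>. (\<integral>\<^sup>+x. U i x \<partial>count_space (X \<omega>)) * Y \<omega> \<partial>M)"
    using seq.hyps(3) by (intro nn_integral_monotone_convergence_SUP)
      (auto simp: incseq_def le_fun_def intro!: mult_right_mono nn_integral_mono)
  also have "\<dots> = (SUP i. \<integral>\<^sup>+x. U i x * w x \<partial>lborel)" using seq.IH by simp
  also have "\<dots> = (\<integral>\<^sup>+x. (SUP i. U i x * w x) \<partial>lborel)"
    using seq.hyps(3) by (intro nn_integral_monotone_convergence_SUP[symmetric])
      (auto simp: incseq_def le_fun_def intro!: mult_right_mono)
  also have "\<dots> = (\<integral>\<^sup>+x. (SUP i. U i) x * w x \<partial>lborel)"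
    by (simp add: image_comp SUP_mult_right_ennreal)
  finally show ?case .
qed

lemma sine_process_first_moment:
  assumes X: "sine_process M X" and f: "f \<in> borel_measurable borel"
  shows "(\<integral>\<^sup>+\<omega>. (\<integral>\<^sup>+x. f x \<partial>count_space (X \<omega>)) \<partial>M) = (\<integral>\<^sup>+x. f x \<partial>lborel)"
  using weighted_Campbell[OF sine_process_point_process[OF X] f, of "\<lambda>_. 1" "\<lambda>_. 1"]
    sine_process_mean[OF X] by simp

text \<open>\<open>weighted_Campbell\<close> is used twice: in \<open>f\<close> with the count of a
  set as weight, then in \<open>g\<close> with the sum of \<open>f\<close> as weight. The term
  \<open>g x\<close> beside the inner integral is the diagonal contribution.\<close>

lemma sine_process_second_moment:
  assumes X: "sine_process M X"
    and f [measurable]: "f \<in> borel_measurable borel" and g [measurable]: "g \<in> borel_measurable borel"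
  shows "(\<integral>\<^sup>+\<omega>. (\<integral>\<^sup>+x. f x \<partial>count_space (X \<omega>)) * (\<integral>\<^sup>+x. g x \<partial>count_space (X \<omega>)) \<partial>M) =
    (\<integral>\<^sup>+x. f x * ((\<integral>\<^sup>+y. g y * ennreal (1 - sinc_square (x - y)) \<partial>lborel) + g x) \<partial>lborel)"
proof -
  note PP = sine_process_point_process[OF X]
  note [measurable] = measurable_linear_statistic[OF PP]
  have num_meas [measurable]: "(\<lambda>\<omega>. num_points (X \<omega> \<inter> A)) \<in> borel_measurable M" if "A \<in> sets borel" for A
    using PP that by (simp add: point_process_def)
  have sets: "(\<integral>\<^sup>+\<omega>. num_points (X \<omega> \<inter> A) * num_points (X \<omega> \<inter> B) \<partial>M) =
      (\<integral>\<^sup>+x. indicator A x * ((\<integral>\<^sup>+y. indicator B y * ennreal (1 - sinc_square (x - y)) \<partial>lborel) + indicator B x) \<partial>lborel)"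
    if A [measurable]: "A \<in> sets borel" and B [measurable]: "B \<in> sets borel" for A B
  proof -
    let ?D = "\<lambda>\<omega>. num_points {p \<in> (X \<omega> \<inter> A) \<times> (X \<omega> \<inter> B). fst p \<noteq> snd p}"
    have Int: "(X \<omega> \<inter> A) \<inter> (X \<omega> \<inter> B) = X \<omega> \<inter> (A \<inter> B)" for \<omega> by auto
    have [measurable]: "?D \<in> borel_measurable M"
      unfolding num_points_distinct_pairs Int by measurable
    have "(\<integral>\<^sup>+\<omega>. num_points (X \<omega> \<inter> A) * num_points (X \<omega> \<inter> B) \<partial>M) =
        (\<integral>\<^sup>+\<omega>. ?D \<omega> + num_points (X \<omega> \<inter> (A \<inter> B)) \<partial>M)"
      unfolding num_points_distinct_pairs_add_diagonal[symmetric] Int ..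
    also have "\<dots> = (\<integral>\<^sup>+\<omega>. ?D \<omega> \<partial>M) + (\<integral>\<^sup>+\<omega>. num_points (X \<omega> \<inter> (A \<inter> B)) \<partial>M)"
      by (rule nn_integral_add) measurable
    also have "\<dots> = (\<integral>\<^sup>+x. indicator A x * (\<integral>\<^sup>+y. indicator B y * ennreal (1 - sinc_square (x - y)) \<partial>lborel) \<partial>lborel)
        + (\<integral>\<^sup>+x. indicator A x * indicator B x \<partial>lborel)"
      using sine_process_distinct_pairs[OF X A B] sine_process_mean[OF X, of "A \<inter> B"]
      by (simp add: num_points_distinct_tuples_2 indicator_inter_arith[symmetric])
    also have "\<dots> = (\<integral>\<^sup>+x. indicator A x * ((\<integral>\<^sup>+y. indicator B y * ennreal (1 - sinc_square (x - y)) \<partial>lborel) + indicator B x) \<partial>lborel)"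
      unfolding distrib_left by (rule nn_integral_add[symmetric]) measurable
    finally show ?thesis .
  qed
  have one_function: "(\<integral>\<^sup>+\<omega>. (\<integral>\<^sup>+x. f x \<partial>count_space (X \<omega>)) * num_points (X \<omega> \<inter> B) \<partial>M) =
      (\<integral>\<^sup>+x. f x * ((\<integral>\<^sup>+y. indicator B y * ennreal (1 - sinc_square (x - y)) \<partial>lborel) + indicator B x) \<partial>lborel)"
    if B [measurable]: "B \<in> sets borel" for B
    by (rule weighted_Campbell[OF PP f]) (use sets[OF _ B] in \<open>auto simp: B\<close>)
  \<comment> \<open>The second use of \<open>weighted_Campbell\<close> needs the other function in
    the outer integral; Tonelli exchanges the two roles.\<close>
  have swap: "(\<integral>\<^sup>+x. f x * ((\<integral>\<^sup>+y. h y * ennreal (1 - sinc_square (x - y)) \<partial>lborel) + h x) \<partial>lborel) =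
      (\<integral>\<^sup>+y. h y * ((\<integral>\<^sup>+x. f x * ennreal (1 - sinc_square (x - y)) \<partial>lborel) + f y) \<partial>lborel)"
    if h [measurable]: "h \<in> borel_measurable borel" for h :: "real \<Rightarrow> ennreal"
  proof -
    have "(\<integral>\<^sup>+x. f x * (\<integral>\<^sup>+y. h y * ennreal (1 - sinc_square (x - y)) \<partial>lborel) \<partial>lborel) =
        (\<integral>\<^sup>+x. \<integral>\<^sup>+y. f x * (h y * ennreal (1 - sinc_square (x - y))) \<partial>lborel \<partial>lborel)"
      by (intro nn_integral_cong nn_integral_cmult[symmetric]) measurable
    also have "\<dots> = (\<integral>\<^sup>+y. \<integral>\<^sup>+x. f x * (h y * ennreal (1 - sinc_square (x - y))) \<partial>lborel \<partial>lborel)"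
      by (rule lborel_pair.Fubini') measurable
    also have "\<dots> = (\<integral>\<^sup>+y. \<integral>\<^sup>+x. h y * (f x * ennreal (1 - sinc_square (x - y))) \<partial>lborel \<partial>lborel)"
      by (simp only: mult.left_commute)
    also have "\<dots> = (\<integral>\<^sup>+y. h y * (\<integral>\<^sup>+x. f x * ennreal (1 - sinc_square (x - y)) \<partial>lborel) \<partial>lborel)"
      by (intro nn_integral_cong nn_integral_cmult) measurable
    finally have *: "(\<integral>\<^sup>+x. f x * (\<integral>\<^sup>+y. h y * ennreal (1 - sinc_square (x - y)) \<partial>lborel) \<partial>lborel) =
        (\<integral>\<^sup>+y. h y * (\<integral>\<^sup>+x. f x * ennreal (1 - sinc_square (x - y)) \<partial>lborel) \<partial>lborel)" .
    have "(\<integral>\<^sup>+x. f x * ((\<integral>\<^sup>+y. h y * ennreal (1 - sinc_square (x - y)) \<partial>lborel) + h x) \<partial>lborel) =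
        (\<integral>\<^sup>+x. f x * (\<integral>\<^sup>+y. h y * ennreal (1 - sinc_square (x - y)) \<partial>lborel) \<partial>lborel) + (\<integral>\<^sup>+x. f x * h x \<partial>lborel)"
      unfolding distrib_left by (rule nn_integral_add) measurable
    also have "\<dots> = (\<integral>\<^sup>+y. h y * (\<integral>\<^sup>+x. f x * ennreal (1 - sinc_square (x - y)) \<partial>lborel) \<partial>lborel) + (\<integral>\<^sup>+x. h x * f x \<partial>lborel)"
      unfolding * by (simp only: mult.commute)
    also have "\<dots> = (\<integral>\<^sup>+y. h y * ((\<integral>\<^sup>+x. f x * ennreal (1 - sinc_square (x - y)) \<partial>lborel) + f y) \<partial>lborel)"
      unfolding distrib_left by (rule nn_integral_add[symmetric]) measurable
    finally show ?thesis .
  qed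
  have gf: "(\<integral>\<^sup>+\<omega>. (\<integral>\<^sup>+x. g x \<partial>count_space (X \<omega>)) * (\<integral>\<^sup>+x. f x \<partial>count_space (X \<omega>)) \<partial>M) =
    (\<integral>\<^sup>+y. g y * ((\<integral>\<^sup>+x. f x * ennreal (1 - sinc_square (x - y)) \<partial>lborel) + f y) \<partial>lborel)"
  proof (rule weighted_Campbell[OF PP g])
    show "(\<lambda>\<omega>. \<integral>\<^sup>+x. f x \<partial>count_space (X \<omega>)) \<in> borel_measurable M"
      by (rule measurable_linear_statistic[OF PP f])
    show "(\<lambda>y. (\<integral>\<^sup>+x. f x * ennreal (1 - sinc_square (x - y)) \<partial>lborel) + f y) \<in> borel_measurable borel"
      by measurable
  next
    fix B :: "real set" assume B [measurable]: "B \<in> sets borel"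
    show "(\<integral>\<^sup>+\<omega>. num_points (X \<omega> \<inter> B) * (\<integral>\<^sup>+x. f x \<partial>count_space (X \<omega>)) \<partial>M) =
      (\<integral>\<^sup>+y. indicator B y * ((\<integral>\<^sup>+x. f x * ennreal (1 - sinc_square (x - y)) \<partial>lborel) + f y) \<partial>lborel)"
      unfolding swap[of "indicator B", OF borel_measurable_indicator[OF B], symmetric] one_function[OF B, symmetric]
      by (intro nn_integral_cong mult.commute)
  qed
  have fg: "(\<integral>\<^sup>+\<omega>. (\<integral>\<^sup>+x. f x \<partial>count_space (X \<omega>)) * (\<integral>\<^sup>+x. g x \<partial>count_space (X \<omega>)) \<partial>M) =
      (\<integral>\<^sup>+\<omega>. (\<integral>\<^sup>+x. g x \<partial>count_space (X \<omega>)) * (\<integral>\<^sup>+x. f x \<partial>count_space (X \<omega>)) \<partial>M)"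
    by (intro nn_integral_cong mult.commute)
  show ?thesis unfolding fg gf by (rule swap[OF g, symmetric])
qed

subsection \<open>Variance of linear statistics\<close>

text \<open>For \<open>R > 0\<close>, the positive part of
  \<open>ln (R / max 1 \<bar>x\<bar>)\<close>: the weight in Jensen's sum with its singularity at 0
  cut off, which makes it bounded.\<close>

definition log_cutoff :: "real \<Rightarrow> real \<Rightarrow> real"
  where "log_cutoff R x = max 0 (ln R - ln (max 1 \<bar>x\<bar>))"

section \<open>Integrals of the squared sine kernel\<close>

lemma nn_integral_even:
  fixes f :: "real \<Rightarrow> ennreal"
  assumes [measurable]: "f \<in> borel_measurable borel" and even: "\<And>x. f (- x) = f x"
  shows "(\<integral>\<^sup>+x. f x \<partial>lborel) = 2 * (\<integral>\<^sup>+x\<in>{0..}. f x \<partial>lborel)"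
proof -
  have "(\<integral>\<^sup>+x\<in>{..0}. f x \<partial>lborel) = (\<integral>\<^sup>+x. f (- x) * indicator {..0} (- x) \<partial>lborel)"
    using nn_integral_real_affine[of "\<lambda>x. f x * indicator {..0} x" "-1" 0] by simp
  also have "\<dots> = (\<integral>\<^sup>+x\<in>{0..}. f x \<partial>lborel)"
    unfolding even by (intro nn_integral_cong) (auto simp: indicator_def)
  finally have neg: "(\<integral>\<^sup>+x\<in>{..0}. f x \<partial>lborel) = (\<integral>\<^sup>+x\<in>{0..}. f x \<partial>lborel)" .
  have "AE x in lborel. x \<noteq> (0::real)" by (rule AE_lborel_singleton)
  then have "(\<integral>\<^sup>+x. f x \<partial>lborel) = (\<integral>\<^sup>+x. f x * indicator {0..} x + f x * indicator {..0} x \<partial>lborel)"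
    by (intro nn_integral_cong_AE) (auto simp: indicator_def elim!: eventually_mono)
  also have "\<dots> = 2 * (\<integral>\<^sup>+x\<in>{0..}. f x \<partial>lborel)"
    by (subst nn_integral_add) (auto simp: neg mult_2)
  finally show ?thesis .
qed

text \<open>The primitive comes from integration by parts: differentiating the squared sine leaves
  \<open>sin (2 * pi * x) / x\<close>, which integrates to the sine integral
  \<open>Si\<close>.\<close>

lemma DERIV_sinc_square_primitive:
  assumes "x > 0"
  shows "((\<lambda>x. Si (2 * pi * x) / pi - (sin (pi * x))\<^sup>2 / (pi\<^sup>2 * x)) has_real_derivative sinc_square x) (at x)"
proof -
  have Si: "((\<lambda>x. Si (2 * pi * x)) has_real_derivative (sin (2 * pi * x) / (2 * pi * x)) * (2 * pi)) (at x)"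
  proof (rule DERIV_chain2[where f = Si])
    show "(Si has_real_derivative sin (2 * pi * x) / (2 * pi * x)) (at (2 * pi * x))"
      using DERIV_Si[of "2 * pi * x"] assms by simp
    show "((\<lambda>x. 2 * pi * x) has_real_derivative 2 * pi) (at x)"
      by (auto intro!: derivative_eq_intros)
  qed
  have sq: "((\<lambda>x. (sin (pi * x))\<^sup>2 / (pi\<^sup>2 * x)) has_real_derivative
      (2 * sin (pi * x) * (cos (pi * x) * pi) * (pi\<^sup>2 * x) - (sin (pi * x))\<^sup>2 * pi\<^sup>2) / ((pi\<^sup>2 * x) * (pi\<^sup>2 * x))) (at x)"
    using assms by (auto intro!: derivative_eq_intros)
  have "sin (2 * pi * x) = 2 * sin (pi * x) * cos (pi * x)"
    using sin_double[of "pi * x"] by (simp add: mult_ac)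
  then have "sin (2 * pi * x) / (2 * pi * x) * (2 * pi) / pi -
      (2 * sin (pi * x) * (cos (pi * x) * pi) * (pi\<^sup>2 * x) - (sin (pi * x))\<^sup>2 * pi\<^sup>2) / ((pi\<^sup>2 * x) * (pi\<^sup>2 * x)) = sinc_square x"
    using assms by (simp add: sinc_square_def field_simps power2_eq_square)
  then show ?thesis using DERIV_diff[OF DERIV_cdivide[OF Si, of pi] sq] by simp
qed

lemma nn_integral_sinc_square_tail:
  assumes a: "a > 0"
  shows "(\<integral>\<^sup>+x\<in>{a..}. ennreal (sinc_square x) \<partial>lborel) = ennreal (1 / 2 - (Si (2 * pi * a) / pi - (sin (pi * a))\<^sup>2 / (pi\<^sup>2 * a)))"
proof (rule nn_integral_FTC_atLeast)
  have Si: "((\<lambda>x. Si (2 * pi * x)) \<longlongrightarrow> pi / 2) at_top"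
    by (rule filterlim_compose[OF Si_at_top]) real_asymp
  have "((\<lambda>x. (sin (pi * x))\<^sup>2 / (pi\<^sup>2 * x)) \<longlongrightarrow> 0) at_top"
  proof (rule Lim_null_comparison)
    show "eventually (\<lambda>x. norm ((sin (pi * x))\<^sup>2 / (pi\<^sup>2 * x)) \<le> 1 / (pi\<^sup>2 * x)) at_top"
      using eventually_gt_at_top[of 0]
      by eventually_elim (auto simp: divide_simps power_le_one abs_square_le_1)
    show "((\<lambda>x. 1 / (pi\<^sup>2 * x)) \<longlongrightarrow> 0) at_top" by real_asymp
  qed
  from tendsto_diff[OF tendsto_divide[OF Si tendsto_const] this, of pi]
  show "((\<lambda>x. Si (2 * pi * x) / pi - (sin (pi * x))\<^sup>2 / (pi\<^sup>2 * x)) \<longlongrightarrow> 1 / 2) at_top" by simp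
qed (use a in \<open>auto intro!: DERIV_sinc_square_primitive sinc_square_nonneg\<close>)

text \<open>A sharp bound: the integral equals 1, since the sine kernel is the kernel of a
  projection. It absorbs the diagonal term of the second moment into a double integral. The
  primitive is used on \<open>{a..}\<close> with \<open>a\<close> tending to 0 because it is a
  quotient by \<open>a\<close>.\<close>

lemma nn_integral_sinc_square_ge: "1 \<le> (\<integral>\<^sup>+x. ennreal (sinc_square x) \<partial>lborel)"
proof -
  define G where "G a = Si (2 * pi * a) / pi - (sin (pi * a))\<^sup>2 / (pi\<^sup>2 * a)" for a
  have "((\<lambda>a. (sin (pi * a))\<^sup>2 / (pi\<^sup>2 * a)) \<longlongrightarrow> 0) (at_right 0)" by real_asymp
  moreover have "((\<lambda>a. Si (2 * pi * a) / pi) \<longlongrightarrow> Si (2 * pi * 0) / pi) (at_right 0)"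
    by (intro tendsto_intros isCont_tendsto_compose[OF isCont_Si])  simp
  moreover have "Si 0 = 0" by (simp add: Si_def zero_ereal_def[symmetric])
  ultimately have "(G \<longlongrightarrow> 0) (at_right 0)"
    unfolding G_def using tendsto_diff by fastforce
  then have "((\<lambda>a. ennreal (2 * (1 / 2 - G a))) \<longlongrightarrow> ennreal (2 * (1 / 2 - 0))) (at_right 0)"
    by (intro tendsto_intros)
  moreover have "ennreal (2 * (1 / 2 - G a)) \<le> (\<integral>\<^sup>+x. ennreal (sinc_square x) \<partial>lborel)" if "a > 0" for a
  proof -
    have "ennreal (2 * (1 / 2 - G a)) = 2 * ennreal (1 / 2 - G a)"
      by (simp add: ennreal_mult' del: right_diff_distrib_numeral)
    also have "\<dots> = 2 * (\<integral>\<^sup>+x\<in>{a..}. ennreal (sinc_square x) \<partial>lborel)"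
      unfolding G_def nn_integral_sinc_square_tail[OF that] ..
    also have "\<dots> \<le> 2 * (\<integral>\<^sup>+x\<in>{0..}. ennreal (sinc_square x) \<partial>lborel)"
      using that by (intro mult_left_mono nn_integral_mono) (auto simp: indicator_def)
    also have "\<dots> = (\<integral>\<^sup>+x. ennreal (sinc_square x) \<partial>lborel)"
      by (rule nn_integral_even[symmetric]) (simp_all add: sinc_square_minus)
    finally show ?thesis .
  qed
  ultimately have "ennreal (2 * (1 / 2 - 0)) \<le> (\<integral>\<^sup>+x. ennreal (sinc_square x) \<partial>lborel)"
    by (intro tendsto_upperbound) (auto simp: eventually_at_filter)
  then show ?thesis by simp
qed

lemma nn_integral_sinc_square_shift:
  "(\<integral>\<^sup>+y. ennreal (sinc_square (x - y)) \<partial>lborel) = (\<integral>\<^sup>+y. ennreal (sinc_square y) \<partial>lborel)"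
  using nn_integral_real_affine[of "\<lambda>y. ennreal (sinc_square y)" "-1" x] by simp

text \<open>In other words, the variance is at most half the double integral of the squared
  differences of \<open>h\<close> against the squared kernel. Only differences of \<open>h\<close>
  enter, so a slowly varying \<open>h\<close> has small variance even if its mean is large. The
  factor 2 avoids halves in \<open>ennreal\<close>.\<close>

lemma sine_process_second_moment_le:
  assumes X: "sine_process M X" and h [measurable]: "h \<in> borel_measurable borel"
    and nonneg: "\<And>x. 0 \<le> h x" and fin: "(\<integral>\<^sup>+x. ennreal (h x) \<partial>lborel) < \<infinity>"
  shows "2 * (\<integral>\<^sup>+\<omega>. (\<integral>\<^sup>+x. ennreal (h x) \<partial>count_space (X \<omega>))\<^sup>2 \<partial>M) \<le>
    2 * (\<integral>\<^sup>+x. ennreal (h x) \<partial>lborel)\<^sup>2 +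
    (\<integral>\<^sup>+x. \<integral>\<^sup>+y. ennreal ((h x - h y)\<^sup>2 * sinc_square (x - y)) \<partial>lborel \<partial>lborel)"
proof -
  let ?k = "\<lambda>x y. sinc_square (x - y)"
  define A where "A = (\<integral>\<^sup>+x. ennreal (h x) \<partial>lborel)"
  define B where "B = (\<integral>\<^sup>+x. ennreal ((h x)\<^sup>2) \<partial>lborel)"
  define C where "C = (\<integral>\<^sup>+x. \<integral>\<^sup>+y. ennreal (h x * h y * ?k x y) \<partial>lborel \<partial>lborel)"
  define D where "D = (\<integral>\<^sup>+x. \<integral>\<^sup>+y. ennreal (h x * h y * (1 - ?k x y)) \<partial>lborel \<partial>lborel)"
  define V where "V = (\<integral>\<^sup>+x. \<integral>\<^sup>+y. ennreal ((h x - h y)\<^sup>2 * ?k x y) \<partial>lborel \<partial>lborel)"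
  have k: "0 \<le> ?k x y" "?k x y \<le> 1" for x y using sinc_square_nonneg sinc_square_le_1 by auto
  have AA: "A\<^sup>2 = (\<integral>\<^sup>+x. \<integral>\<^sup>+y. ennreal (h x * h y) \<partial>lborel \<partial>lborel)"
  proof -
    have "A\<^sup>2 = (\<integral>\<^sup>+x. ennreal (h x) * A \<partial>lborel)"
      by (simp add: power2_eq_square nn_integral_multc A_def)
    then show ?thesis by (simp add: A_def nn_integral_cmult ennreal_mult nonneg)
  qed
  \<comment> \<open>Finiteness of \<open>C\<close> licenses its cancellation in
    \<open>ennreal\<close> at the end.\<close>
  have "C \<le> A\<^sup>2"
    unfolding C_def AA using nonneg k by (intro nn_integral_mono ennreal_leI mult_left_le) auto
  then have C: "C \<noteq> \<infinity>" using fin unfolding A_def[symmetric] by (auto simp: power2_eq_square ennreal_mult_eq_top_iff top_unique less_top[symmetric])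
  have "(\<integral>\<^sup>+\<omega>. (\<integral>\<^sup>+x. ennreal (h x) \<partial>count_space (X \<omega>))\<^sup>2 \<partial>M) =
      (\<integral>\<^sup>+x. ennreal (h x) * ((\<integral>\<^sup>+y. ennreal (h y) * ennreal (1 - ?k x y) \<partial>lborel) + ennreal (h x)) \<partial>lborel)"
    unfolding power2_eq_square by (rule sine_process_second_moment[OF X]) measurable
  also have "\<dots> = (\<integral>\<^sup>+x. (\<integral>\<^sup>+y. ennreal (h x * h y * (1 - ?k x y)) \<partial>lborel) + ennreal ((h x)\<^sup>2) \<partial>lborel)"
    using k nonneg
    by (intro nn_integral_cong) (simp add: distrib_left nn_integral_cmult[symmetric] ennreal_mult power2_eq_square mult.assoc)
  also have "\<dots> = D + B" unfolding D_def B_def by (rule nn_integral_add) measurable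
  finally have E: "(\<integral>\<^sup>+\<omega>. (\<integral>\<^sup>+x. ennreal (h x) \<partial>count_space (X \<omega>))\<^sup>2 \<partial>M) = D + B" .
  have "D + C = (\<integral>\<^sup>+x. \<integral>\<^sup>+y. ennreal (h x * h y * (1 - ?k x y)) + ennreal (h x * h y * ?k x y) \<partial>lborel \<partial>lborel)"
    unfolding D_def C_def by (simp add: nn_integral_add)
  also have "\<dots> = A\<^sup>2"
    unfolding AA
  proof (intro nn_integral_cong)
    fix x y
    have "0 \<le> h x * h y * (1 - ?k x y)" "0 \<le> h x * h y * ?k x y" using k nonneg by simp_all
    then show "ennreal (h x * h y * (1 - ?k x y)) + ennreal (h x * h y * ?k x y) = ennreal (h x * h y)"
      by (subst ennreal_plus[symmetric]) (simp_all add: right_diff_distrib)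
  qed
  finally have DC: "D + C = A\<^sup>2" .
  \<comment> \<open>The kernel has mass at least 1, so \<open>B\<close> is bounded by double
    integrals of \<open>(h x)\<^sup>2\<close> and, by symmetry, of \<open>(h y)\<^sup>2\<close>
    against it. Their sum is the squared difference plus twice the mixed term, that is
    \<open>V + (C + C)\<close>.\<close>
  have "B * 1 \<le> B * (\<integral>\<^sup>+y. ennreal (sinc_square y) \<partial>lborel)"
    by (intro mult_left_mono nn_integral_sinc_square_ge) auto
  also have "\<dots> = (\<integral>\<^sup>+x. ennreal ((h x)\<^sup>2) * (\<integral>\<^sup>+y. ennreal (?k x y) \<partial>lborel) \<partial>lborel)"
    by (simp add: nn_integral_sinc_square_shift nn_integral_multc B_def)
  also have "\<dots> = (\<integral>\<^sup>+x. \<integral>\<^sup>+y. ennreal ((h x)\<^sup>2 * ?k x y) \<partial>lborel \<partial>lborel)"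
    by (simp add: nn_integral_cmult[symmetric] ennreal_mult k)
  finally have B1: "B \<le> (\<integral>\<^sup>+x. \<integral>\<^sup>+y. ennreal ((h x)\<^sup>2 * ?k x y) \<partial>lborel \<partial>lborel)" by simp
  also have "\<dots> = (\<integral>\<^sup>+y. \<integral>\<^sup>+x. ennreal ((h x)\<^sup>2 * ?k x y) \<partial>lborel \<partial>lborel)"
    by (rule lborel_pair.Fubini') measurable
  also have "\<dots> = (\<integral>\<^sup>+x. \<integral>\<^sup>+y. ennreal ((h y)\<^sup>2 * ?k x y) \<partial>lborel \<partial>lborel)"
    using sinc_square_minus[of "x - y" for x y] by (intro nn_integral_cong) simp
  finally have "B + B \<le> (\<integral>\<^sup>+x. \<integral>\<^sup>+y. ennreal ((h x)\<^sup>2 * ?k x y) \<partial>lborel \<partial>lborel) +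
      (\<integral>\<^sup>+x. \<integral>\<^sup>+y. ennreal ((h y)\<^sup>2 * ?k x y) \<partial>lborel \<partial>lborel)"
    using B1 by (intro add_mono)
  also have "\<dots> = (\<integral>\<^sup>+x. \<integral>\<^sup>+y. ennreal ((h x)\<^sup>2 * ?k x y) + ennreal ((h y)\<^sup>2 * ?k x y) \<partial>lborel \<partial>lborel)"
    by (simp add: nn_integral_add)
  also have "\<dots> = (\<integral>\<^sup>+x. \<integral>\<^sup>+y. ennreal ((h x - h y)\<^sup>2 * ?k x y) + (ennreal (h x * h y * ?k x y) + ennreal (h x * h y * ?k x y)) \<partial>lborel \<partial>lborel)"
  proof (intro nn_integral_cong)
    fix x y
    have "0 \<le> (h x)\<^sup>2 * ?k x y" "0 \<le> (h y)\<^sup>2 * ?k x y" "0 \<le> (h x - h y)\<^sup>2 * ?k x y" "0 \<le> h x * h y * ?k x y"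
      using k nonneg by simp_all
    moreover have "(h x)\<^sup>2 * ?k x y + (h y)\<^sup>2 * ?k x y = (h x - h y)\<^sup>2 * ?k x y + (h x * h y * ?k x y + h x * h y * ?k x y)"
      by (simp add: power2_eq_square algebra_simps)
    ultimately show "ennreal ((h x)\<^sup>2 * ?k x y) + ennreal ((h y)\<^sup>2 * ?k x y) =
        ennreal ((h x - h y)\<^sup>2 * ?k x y) + (ennreal (h x * h y * ?k x y) + ennreal (h x * h y * ?k x y))"
      by (metis ennreal_plus add_nonneg_nonneg)
  qed
  also have "\<dots> = V + (C + C)"
    unfolding V_def C_def by (simp add: nn_integral_add)
  finally have BV: "B + B \<le> V + (C + C)" .
  have "(C + C) + 2 * (D + B) = 2 * A\<^sup>2 + (B + B)"
    unfolding DC[symmetric] by (simp only: mult_2 add_ac)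
  also have "\<dots> \<le> 2 * A\<^sup>2 + (V + (C + C))" by (intro add_left_mono BV)
  also have "\<dots> = (C + C) + (2 * A\<^sup>2 + V)" by (simp add: add_ac)
  finally have "2 * (D + B) \<le> 2 * A\<^sup>2 + V"
    using C by (simp add: ennreal_add_left_cancel_le)
  then show ?thesis unfolding E A_def V_def .
qed

section \<open>Mean and energy of the logarithmic test function\<close>

lemma measurable_log_cutoff [measurable]: "log_cutoff R \<in> borel_measurable borel"
  unfolding log_cutoff_def by measurable

lemma log_cutoff_nonneg: "0 \<le> log_cutoff R x"
  by (simp add: log_cutoff_def)

lemma log_cutoff_minus: "log_cutoff R (- x) = log_cutoff R x"
  by (simp add: log_cutoff_def)

lemma log_cutoff_eq_0: "1 \<le> R \<Longrightarrow> R \<le> \<bar>x\<bar> \<Longrightarrow> log_cutoff R x = 0"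
  by (simp add: log_cutoff_def)

lemma nn_integral_log_cutoff:
  assumes R: "1 \<le> R"
  shows "(\<integral>\<^sup>+x. ennreal (log_cutoff R x) \<partial>lborel) = ennreal (2 * R - 2)"
proof -
  have "(\<integral>\<^sup>+x\<in>{0..}. ennreal (log_cutoff R x) \<partial>lborel) =
      (\<integral>\<^sup>+x. ennreal (ln R) * indicator {0..1} x + ennreal (ln R - ln x) * indicator {1..R} x \<partial>lborel)"
  proof (rule nn_integral_cong_AE)
    show "AE x in lborel. ennreal (log_cutoff R x) * indicator {0..} x =
        ennreal (ln R) * indicator {0..1} x + ennreal (ln R - ln x) * indicator {1..R} x"
      using AE_lborel_singleton[of 1]
    proof eventually_elim
      case (elim x)
      consider "x < 0" | "0 \<le> x" "x < 1" | "1 < x" "x \<le> R" | "R < x" "1 < x" using elim by linarith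
      then show ?case
      proof cases
        case 3
        then have "ln x \<le> ln R" by simp
        with 3 show ?thesis by (simp add: log_cutoff_def max_def)
      next
        case 4
        then have "ln R \<le> ln x" using R by simp
        with 4 show ?thesis by (simp add: log_cutoff_def max_def)
      qed (use R in \<open>auto simp: log_cutoff_def max_def\<close>)
    qed
  qed
  also have "\<dots> = ennreal (ln R) + (\<integral>\<^sup>+x\<in>{1..R}. ennreal (ln R - ln x) \<partial>lborel)"
    by (subst nn_integral_add) (auto simp: nn_integral_cmult)
  also have "(\<integral>\<^sup>+x\<in>{1..R}. ennreal (ln R - ln x) \<partial>lborel) =
      ennreal ((R * (ln R - ln R) + R) - (1 * (ln R - ln 1) + 1))"
    using R by (intro nn_integral_FTC_Icc[where F = "\<lambda>x. x * (ln R - ln x) + x"])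
      (auto intro!: derivative_eq_intros simp: has_real_derivative_iff_has_vector_derivative[symmetric])
  also have "ennreal (ln R) + \<dots> = ennreal (R - 1)"
    using R ln_le_minus_one[of R] by (subst ennreal_plus[symmetric]) auto
  finally have "(\<integral>\<^sup>+x\<in>{0..}. ennreal (log_cutoff R x) \<partial>lborel) = ennreal (R - 1)" .
  then have "(\<integral>\<^sup>+x. ennreal (log_cutoff R x) \<partial>lborel) = 2 * ennreal (R - 1)"
    by (subst nn_integral_even) (simp_all add: log_cutoff_minus)
  also have "\<dots> = ennreal (2 * (R - 1))"
    using R by (subst ennreal_mult) auto
  finally show ?thesis by (simp add: right_diff_distrib)
qed

text \<open>The simpler bound \<open>(a - b)\<^sup>2 / (a * b)\<close> would only give a variance of order \<open>(ln R)\<^sup>2\<close>, which is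
  too large. Working with fourth roots gives additional decay as \<open>a / b\<close> grows.\<close>
lemma ln_diff_square_le:
  fixes a b :: real
  assumes b: "0 < b" and ab: "b \<le> a"
  shows "(ln a - ln b)\<^sup>2 \<le> 16 * (a - b)\<^sup>2 / (a * sqrt (a * b))"
proof -
  define p q where "p = sqrt (sqrt a)" and "q = sqrt (sqrt b)"
  have pos: "0 < p" "0 < q" "q \<le> p" using b ab by (auto simp: p_def q_def)
  have p2: "p\<^sup>2 = sqrt a" and q2: "q\<^sup>2 = sqrt b" using b ab by (auto simp: p_def q_def)
  have p4: "p ^ 4 = a" and q4: "q ^ 4 = b"
    using b ab power_mult[of p 2 2] power_mult[of q 2 2] by (simp_all add: p2 q2)
  have "ln a - ln b = 4 * ln (p / q)"
    using pos by (simp add: p4[symmetric] q4[symmetric] ln_div ln_realpow)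
  also have "\<dots> \<le> 4 * (p / q - 1)" using pos ln_le_minus_one[of "p / q"] by simp
  also have "\<dots> = 4 * ((p - q) * p ^ 3) / (p ^ 3 * q)"
    using pos by (simp add: field_simps)
  also have "\<dots> \<le> 4 * (a - b) / (p ^ 3 * q)"
  proof -
    have "q * q ^ 3 \<le> q * p ^ 3" using pos by (intro mult_left_mono power_mono) auto
    then have "(p - q) * p ^ 3 \<le> a - b"
      by (simp add: p4[symmetric] q4[symmetric] left_diff_distrib flip: power_Suc)
    then show ?thesis using pos by (intro divide_right_mono) auto
  qed
  finally have "ln a - ln b \<le> 4 * (a - b) / (p ^ 3 * q)" .
  then have "(ln a - ln b)\<^sup>2 \<le> (4 * (a - b) / (p ^ 3 * q))\<^sup>2"
    using b ab by (intro power_mono) auto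
  also have "\<dots> = (4 * (a - b))\<^sup>2 / (p ^ 3 * q)\<^sup>2" by (rule power_divide)
  also have "(4 * (a - b))\<^sup>2 = 16 * (a - b)\<^sup>2" by (simp add: power2_eq_square algebra_simps)
  also have "(p ^ 3 * q)\<^sup>2 = p ^ 4 * (p\<^sup>2 * q\<^sup>2)"
    by (simp add: power_mult_distrib flip: power_mult power_add)
  finally show ?thesis by (simp add: p4 p2 q2 real_sqrt_mult)
qed

lemma sinc_square_le: "u \<noteq> 0 \<Longrightarrow> sinc_square u \<le> 1 / u\<^sup>2"
proof -
  assume u: "u \<noteq> 0"
  have "(sin (pi * u))\<^sup>2 \<le> 1" by (simp add: abs_square_le_1)
  also have "1 \<le> pi\<^sup>2" using pi_gt3 by (intro one_le_power) simp
  finally show ?thesis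
    using u by (simp add: sinc_square_def power_divide power_mult_distrib divide_simps)
qed

text \<open>A symmetric majorant of the energy density, free of \<open>R\<close>. With
  \<open>s\<close> the larger and \<open>t\<close> the smaller of \<open>1 + \<bar>x\<bar>\<close>
  and \<open>1 + \<bar>y\<bar>\<close>, it is 64 times s^(-3/2) t^(-1/2): the exponent of
  \<open>s\<close> makes it integrable in either variable. The constant is 16 from
  \<open>ln_diff_square_le\<close> times 4 for replacing \<open>max 1 \<bar>x\<bar>\<close> by
  \<open>1 + \<bar>x\<bar>\<close>.\<close>

definition variance_kernel :: "real \<Rightarrow> real \<Rightarrow> real"
  where "variance_kernel x y = 64 / (max (1 + \<bar>x\<bar>) (1 + \<bar>y\<bar>) * sqrt ((1 + \<bar>x\<bar>) * (1 + \<bar>y\<bar>)))"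

lemma variance_kernel_commute: "variance_kernel x y = variance_kernel y x"
  by (simp add: variance_kernel_def max.commute mult.commute)

lemma variance_kernel_nonneg: "0 \<le> variance_kernel x y"
  by (simp add: variance_kernel_def le_max_iff_disj)

lemma measurable_variance_kernel [measurable (raw)]:
  assumes [measurable]: "f \<in> borel_measurable N" "g \<in> borel_measurable N"
  shows "(\<lambda>x. variance_kernel (f x) (g x)) \<in> borel_measurable N"
  unfolding variance_kernel_def by measurable

text \<open>The squared difference of logarithms carries a factor \<open>(x - y)\<^sup>2\<close>,
  which cancels the bound \<open>1 / (x - y)\<^sup>2\<close> for the squared kernel. Capping at 1
  from below and at \<open>R\<close> from above only shrinks distances.\<close>

lemma log_cutoff_diff_square_le:
  assumes R: "1 \<le> R" and xy: "\<bar>x\<bar> \<le> \<bar>y\<bar>"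
  shows "(log_cutoff R x - log_cutoff R y)\<^sup>2 * sinc_square (x - y) \<le> variance_kernel x y"
proof (cases "x = y")
  case False
  define a b where "a = max 1 \<bar>y\<bar>" and "b = max 1 \<bar>x\<bar>"
  have ab: "1 \<le> b" "b \<le> a" using xy by (auto simp: a_def b_def)
  have "(log_cutoff R x - log_cutoff R y)\<^sup>2 \<le> (ln a - ln b)\<^sup>2"
  proof -
    have "ln b \<le> ln a" using ab by simp
    then have "\<bar>log_cutoff R x - log_cutoff R y\<bar> \<le> \<bar>ln a - ln b\<bar>"
      unfolding log_cutoff_def a_def b_def by linarith
    then show ?thesis by (simp only: abs_le_square_iff)
  qed
  also have "\<dots> \<le> 16 * (a - b)\<^sup>2 / (a * sqrt (a * b))"
    using ab by (intro ln_diff_square_le) auto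
  also have "\<dots> \<le> 16 * (x - y)\<^sup>2 / (a * sqrt (a * b))"
  proof -
    have "\<bar>a - b\<bar> \<le> \<bar>x - y\<bar>" unfolding a_def b_def by linarith
    then have "(a - b)\<^sup>2 \<le> (x - y)\<^sup>2" by (simp only: abs_le_square_iff)
    then show ?thesis using ab by (intro divide_right_mono mult_left_mono) auto
  qed
  also have "\<dots> \<le> 16 * (x - y)\<^sup>2 / (max (1 + \<bar>x\<bar>) (1 + \<bar>y\<bar>) * sqrt ((1 + \<bar>x\<bar>) * (1 + \<bar>y\<bar>)) / 4)"
  proof -
    have a: "1 + \<bar>y\<bar> \<le> 2 * a" and b: "1 + \<bar>x\<bar> \<le> 2 * b" by (auto simp: a_def b_def)
    have "sqrt ((1 + \<bar>x\<bar>) * (1 + \<bar>y\<bar>)) \<le> sqrt (2 * b * (2 * a))"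
      using a b by (intro real_sqrt_le_mono mult_mono) auto
    also have "\<dots> = 2 * sqrt (a * b)"
      using real_sqrt_mult[of 4 "a * b"] by (simp add: mult_ac)
    finally have "max (1 + \<bar>x\<bar>) (1 + \<bar>y\<bar>) * sqrt ((1 + \<bar>x\<bar>) * (1 + \<bar>y\<bar>)) \<le> 2 * a * (2 * sqrt (a * b))"
      using a xy ab by (intro mult_mono) auto
    then show ?thesis using ab by (intro divide_left_mono) (auto intro!: mult_pos_pos simp: less_max_iff_disj)
  qed
  also have "\<dots> = variance_kernel x y * (x - y)\<^sup>2" by (simp add: variance_kernel_def)
  finally have "(log_cutoff R x - log_cutoff R y)\<^sup>2 * sinc_square (x - y) \<le> variance_kernel x y * (x - y)\<^sup>2 * (1 / (x - y)\<^sup>2)"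
    using False by (intro mult_mono sinc_square_le) (auto simp: sinc_square_nonneg variance_kernel_nonneg)
  with False show ?thesis by simp
qed (simp add: variance_kernel_nonneg)

text \<open>On the half-line the integral is split at \<open>\<bar>x\<bar>\<close>, where the
  maximum changes. Each piece contributes at most \<open>128 / (1 + \<bar>x\<bar>)\<close>, and
  evenness in \<open>y\<close> doubles the total \<open>256 / (1 + \<bar>x\<bar>)\<close>.\<close>

lemma nn_integral_variance_kernel_le:
  "(\<integral>\<^sup>+y. ennreal (variance_kernel x y) \<partial>lborel) \<le> ennreal (512 / (1 + \<bar>x\<bar>))"
proof -
  define b where "b = 1 + \<bar>x\<bar>"
  have b: "1 \<le> b" by (simp add: b_def)
  define c d where "c = 64 / (b * sqrt b)" and "d = 64 / sqrt b"
  have cd: "0 \<le> c" "0 \<le> d" using b by (auto simp: c_def d_def)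
  have near: "(\<integral>\<^sup>+y\<in>{0..\<bar>x\<bar>}. ennreal (1 / sqrt (1 + y)) \<partial>lborel) = ennreal (2 * sqrt (1 + \<bar>x\<bar>) - 2 * sqrt (1 + 0))"
    by (intro nn_integral_FTC_Icc[where F = "\<lambda>y. 2 * sqrt (1 + y)"])
      (auto intro!: derivative_eq_intros simp: field_simps)
  have "((\<lambda>y. - 2 / sqrt (1 + y)) \<longlongrightarrow> 0) at_top" by real_asymp
  then have far: "(\<integral>\<^sup>+y\<in>{\<bar>x\<bar>..}. ennreal (1 / ((1 + y) * sqrt (1 + y))) \<partial>lborel) = ennreal (0 - - 2 / sqrt (1 + \<bar>x\<bar>))"
    by (intro nn_integral_FTC_atLeast[where F = "\<lambda>y. - 2 / sqrt (1 + y)"])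
      (auto intro!: derivative_eq_intros simp: field_simps)
  have "(\<integral>\<^sup>+y\<in>{0..}. ennreal (variance_kernel x y) \<partial>lborel) \<le>
      (\<integral>\<^sup>+y. ennreal c * (ennreal (1 / sqrt (1 + y)) * indicator {0..\<bar>x\<bar>} y)
        + ennreal d * (ennreal (1 / ((1 + y) * sqrt (1 + y))) * indicator {\<bar>x\<bar>..} y) \<partial>lborel)"
  proof (intro nn_integral_mono)
    fix y :: real
    consider "y < 0" | "0 \<le> y" "y \<le> \<bar>x\<bar>" | "\<bar>x\<bar> < y" by linarith
    then show "ennreal (variance_kernel x y) * indicator {0..} y \<le> ennreal c * (ennreal (1 / sqrt (1 + y)) * indicator {0..\<bar>x\<bar>} y)
        + ennreal d * (ennreal (1 / ((1 + y) * sqrt (1 + y))) * indicator {\<bar>x\<bar>..} y)"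
    proof cases
      case 2
      then have "variance_kernel x y = c * (1 / sqrt (1 + y))"
        by (simp add: variance_kernel_def c_def b_def max_def real_sqrt_mult)
      then have "ennreal (variance_kernel x y) = ennreal c * ennreal (1 / sqrt (1 + y))"
        using ennreal_mult'[OF cd(1)] by (simp only:)
      then show ?thesis using 2 by simp
    next
      case 3
      then have "variance_kernel x y = d * (1 / ((1 + y) * sqrt (1 + y)))"
        by (simp add: variance_kernel_def d_def b_def max_def real_sqrt_mult mult_ac)
      then have "ennreal (variance_kernel x y) = ennreal d * ennreal (1 / ((1 + y) * sqrt (1 + y)))"
        using ennreal_mult'[OF cd(2)] by (simp only:)
      then show ?thesis using 3 by simp
    qed simp
  qed
  also have "\<dots> = ennreal c * ennreal (2 * sqrt b - 2) + ennreal d * ennreal (2 / sqrt b)"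
    by (subst nn_integral_add) (auto simp: nn_integral_cmult near far b_def)
  also have "\<dots> = ennreal (c * (2 * sqrt b - 2) + d * (2 / sqrt b))"
    using b cd by (simp add: ennreal_mult'[symmetric])
  also have "\<dots> \<le> ennreal (256 / b)"
  proof (intro ennreal_leI)
    have "c * (2 * sqrt b - 2) \<le> c * (2 * sqrt b)" using cd by (intro mult_left_mono) auto
    also have "\<dots> = 128 / b" using b by (simp add: c_def)
    finally show "c * (2 * sqrt b - 2) + d * (2 / sqrt b) \<le> 256 / b"
      using b by (simp add: d_def)
  qed
  finally have "2 * (\<integral>\<^sup>+y\<in>{0..}. ennreal (variance_kernel x y) \<partial>lborel) \<le> 2 * ennreal (256 / b)"
    by (intro mult_left_mono) auto
  also have "\<dots> = ennreal (512 / b)"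
    using b by (simp add: ennreal_mult'[symmetric] flip: ennreal_numeral)
  also have "2 * (\<integral>\<^sup>+y\<in>{0..}. ennreal (variance_kernel x y) \<partial>lborel) = (\<integral>\<^sup>+y. ennreal (variance_kernel x y) \<partial>lborel)"
    by (rule nn_integral_even[symmetric]) (simp_all add: variance_kernel_def)
  finally show ?thesis by (simp add: b_def)
qed

text \<open>The integrand vanishes unless one of \<open>x\<close>, \<open>y\<close> lies in
  \<open>{-R..R}\<close>. By symmetry both cases cost the same, namely the integral of
  \<open>512 / (1 + \<bar>x\<bar>)\<close> over that interval, which is where the logarithm
  arises.\<close>

lemma log_cutoff_energy_le:
  assumes R: "1 \<le> R"
  shows "(\<integral>\<^sup>+x. \<integral>\<^sup>+y. ennreal ((log_cutoff R x - log_cutoff R y)\<^sup>2 * sinc_square (x - y)) \<partial>lborel \<partial>lborel) \<le>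
    ennreal (2048 * ln (1 + R))"
proof -
  let ?W = "\<lambda>x y. ennreal (variance_kernel x y)" and ?I = "\<lambda>x. indicator {-R..R} x :: ennreal"
  have pointwise: "ennreal ((log_cutoff R x - log_cutoff R y)\<^sup>2 * sinc_square (x - y)) \<le> ?I x * ?W x y + ?I y * ?W x y" for x y
  proof (cases "R \<le> \<bar>x\<bar> \<and> R \<le> \<bar>y\<bar>")
    case True
    then show ?thesis using R by (simp add: log_cutoff_eq_0)
  next
    case False
    have "(log_cutoff R x - log_cutoff R y)\<^sup>2 * sinc_square (x - y) \<le> variance_kernel x y"
    proof (cases "\<bar>x\<bar> \<le> \<bar>y\<bar>")
      case False
      then have "(log_cutoff R y - log_cutoff R x)\<^sup>2 * sinc_square (y - x) \<le> variance_kernel y x"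
        by (intro log_cutoff_diff_square_le R) auto
      then show ?thesis
        using sinc_square_minus[of "x - y"] by (simp add: variance_kernel_commute power2_commute)
    qed (rule log_cutoff_diff_square_le[OF R])
    moreover have "1 * ?W x y \<le> (?I x + ?I y) * ?W x y"
      using False by (intro mult_right_mono) (auto simp: indicator_def abs_le_iff not_le)
    ultimately show ?thesis by (simp add: distrib_right) (meson ennreal_leI order_trans)
  qed
  have half: "(\<integral>\<^sup>+x. \<integral>\<^sup>+y. ?I x * ?W x y \<partial>lborel \<partial>lborel) \<le> ennreal (1024 * ln (1 + R))"
  proof -
    have "(\<integral>\<^sup>+x. \<integral>\<^sup>+y. ?I x * ?W x y \<partial>lborel \<partial>lborel) = (\<integral>\<^sup>+x. ?I x * (\<integral>\<^sup>+y. ?W x y \<partial>lborel) \<partial>lborel)"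
      by (intro nn_integral_cong nn_integral_cmult) measurable
    also have "\<dots> \<le> (\<integral>\<^sup>+x. ?I x * ennreal (512 / (1 + \<bar>x\<bar>)) \<partial>lborel)"
      by (intro nn_integral_mono mult_left_mono nn_integral_variance_kernel_le) auto
    also have "\<dots> = 2 * (\<integral>\<^sup>+x\<in>{0..}. ?I x * ennreal (512 / (1 + \<bar>x\<bar>)) \<partial>lborel)"
      by (rule nn_integral_even) (auto simp: indicator_def)
    also have "(\<integral>\<^sup>+x\<in>{0..}. ?I x * ennreal (512 / (1 + \<bar>x\<bar>)) \<partial>lborel) = (\<integral>\<^sup>+x\<in>{0..R}. ennreal (512 / (1 + x)) \<partial>lborel)"
      by (intro nn_integral_cong) (auto simp: indicator_def)
    also have "\<dots> = ennreal (512 * ln (1 + R) - 512 * ln (1 + 0))"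
      using R by (intro nn_integral_FTC_Icc[where F = "\<lambda>x. 512 * ln (1 + x)"])
        (auto intro!: derivative_eq_intros)
    also have "2 * \<dots> = ennreal (1024 * ln (1 + R))"
      using R by (simp add: ennreal_mult'[symmetric] flip: ennreal_numeral)
    finally show ?thesis .
  qed
  have "(\<integral>\<^sup>+x. \<integral>\<^sup>+y. ennreal ((log_cutoff R x - log_cutoff R y)\<^sup>2 * sinc_square (x - y)) \<partial>lborel \<partial>lborel) \<le>
      (\<integral>\<^sup>+x. \<integral>\<^sup>+y. ?I x * ?W x y + ?I y * ?W x y \<partial>lborel \<partial>lborel)"
    by (intro nn_integral_mono pointwise)
  also have "\<dots> = (\<integral>\<^sup>+x. \<integral>\<^sup>+y. ?I x * ?W x y \<partial>lborel \<partial>lborel) + (\<integral>\<^sup>+x. \<integral>\<^sup>+y. ?I y * ?W x y \<partial>lborel \<partial>lborel)"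
    by (simp add: nn_integral_add)
  also have "(\<integral>\<^sup>+x. \<integral>\<^sup>+y. ?I y * ?W x y \<partial>lborel \<partial>lborel) = (\<integral>\<^sup>+y. \<integral>\<^sup>+x. ?I y * ?W x y \<partial>lborel \<partial>lborel)"
    by (rule lborel_pair.Fubini') measurable
  also have "\<dots> = (\<integral>\<^sup>+x. \<integral>\<^sup>+y. ?I x * ?W x y \<partial>lborel \<partial>lborel)"
    by (intro nn_integral_cong) (simp add: variance_kernel_commute)
  also have "(\<integral>\<^sup>+x. \<integral>\<^sup>+y. ?I x * ?W x y \<partial>lborel \<partial>lborel) + \<dots> \<le> ennreal (1024 * ln (1 + R)) + ennreal (1024 * ln (1 + R))"
    by (intro add_mono half)
  also have "\<dots> = ennreal (2048 * ln (1 + R))"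
    using R by (subst ennreal_plus[symmetric]) auto
  finally show ?thesis .
qed

subsection \<open>Almost sure bounds and completeness\<close>

text \<open>Real-valued so that expectation and variance apply; \<open>enn2real\<close> would read
  an infinite sum as 0.\<close>

definition log_statistic :: "real \<Rightarrow> real \<Rightarrow> real set \<Rightarrow> real"
  where "log_statistic R \<mu> L = enn2real (\<integral>\<^sup>+x. ennreal (log_cutoff R (x - \<mu>)) \<partial>count_space L)"

lemma log_cutoff_le: "0 < \<bar>u\<bar> \<Longrightarrow> \<bar>u\<bar> < R \<Longrightarrow> log_cutoff R u \<le> ln (R / \<bar>u\<bar>)"
  by (auto simp: log_cutoff_def ln_div max_def)

text \<open>Links the statistic to Jensen's sum. A point at \<open>\<mu>\<close> itself would add
  \<open>ln R\<close> on the left and nothing on the right, hence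
  \<open>\<mu> \<notin> L\<close>.\<close>

lemma log_statistic_le:
  assumes R: "1 \<le> R" and fin: "finite {l \<in> L. 0 < \<bar>l - \<mu>\<bar> \<and> \<bar>l - \<mu>\<bar> < R}" and \<mu>: "\<mu> \<notin> L"
  shows "log_statistic R \<mu> L \<le> (\<Sum>l | l \<in> L \<and> 0 < \<bar>l - \<mu>\<bar> \<and> \<bar>l - \<mu>\<bar> < R. ln (R / \<bar>l - \<mu>\<bar>))"
proof -
  let ?A = "{l \<in> L. 0 < \<bar>l - \<mu>\<bar> \<and> \<bar>l - \<mu>\<bar> < R}"
  have "log_cutoff R (l - \<mu>) = 0" if "l \<in> L" "l \<notin> ?A" for l
    using that \<mu> by (intro log_cutoff_eq_0 R) auto
  then have "(\<integral>\<^sup>+x. ennreal (log_cutoff R (x - \<mu>)) \<partial>count_space L) = (\<Sum>l\<in>?A. ennreal (log_cutoff R (l - \<mu>)))"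
    by (intro nn_integral_count_space' fin) auto
  also have "\<dots> = ennreal (\<Sum>l\<in>?A. log_cutoff R (l - \<mu>))"
    by (rule sum_ennreal) (simp add: log_cutoff_nonneg)
  finally have "log_statistic R \<mu> L = (\<Sum>l\<in>?A. log_cutoff R (l - \<mu>))"
    by (simp add: log_statistic_def log_cutoff_nonneg sum_nonneg)
  also have "\<dots> \<le> (\<Sum>l\<in>?A. ln (R / \<bar>l - \<mu>\<bar>))" by (intro sum_mono log_cutoff_le) auto
  finally show ?thesis .
qed

lemma nn_integral_lborel_translate:
  fixes f :: "real \<Rightarrow> ennreal"
  assumes "f \<in> borel_measurable borel"
  shows "(\<integral>\<^sup>+x. f (x - t) \<partial>lborel) = (\<integral>\<^sup>+x. f x \<partial>lborel)"
  using nn_integral_real_affine[OF assms, of 1 "- t"] by simp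

lemma measurable_log_statistic:
  assumes "point_process M X"
  shows "(\<lambda>\<omega>. log_statistic R \<mu> (X \<omega>)) \<in> borel_measurable M"
  unfolding log_statistic_def
  by (intro borel_measurable_enn2real measurable_linear_statistic[OF assms]) measurable

text \<open>Chebyshev's inequality with mean \<open>2 * R - 2\<close> and variance at most half of
  the energy bound \<open>2048 * ln (1 + R)\<close>. Translation invariance of Lebesgue measure
  eliminates \<open>\<mu>\<close>.\<close>

lemma log_statistic_deviation:
  assumes X: "sine_process M X" and R: "1 \<le> R" and a: "0 < a"
  shows "measure M {\<omega> \<in> space M. a \<le> \<bar>log_statistic R \<mu> (X \<omega>) - (2 * R - 2)\<bar>} \<le> 1024 * ln (1 + R) / a\<^sup>2"
proof -
  have PP: "point_process M X" by (rule sine_process_point_process[OF X])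
  then interpret prob_space M by (simp add: point_process_def)
  define h where "h x = log_cutoff R (x - \<mu>)" for x
  have h [measurable]: "h \<in> borel_measurable borel" unfolding h_def by measurable
  define S where "S \<omega> = (\<integral>\<^sup>+x. ennreal (h x) \<partial>count_space (X \<omega>))" for \<omega>
  define Y where "Y \<omega> = log_statistic R \<mu> (X \<omega>)" for \<omega>
  have S [measurable]: "S \<in> borel_measurable M"
    unfolding S_def by (intro measurable_linear_statistic[OF PP]) measurable
  have Y [measurable]: "Y \<in> borel_measurable M"
    unfolding Y_def by (rule measurable_log_statistic[OF PP])
  have Y_S: "Y \<omega> = enn2real (S \<omega>)" for \<omega> by (simp add: Y_def S_def h_def log_statistic_def)
  have int_h: "(\<integral>\<^sup>+x. ennreal (h x) \<partial>lborel) = ennreal (2 * R - 2)"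
    using nn_integral_lborel_translate[of "\<lambda>x. ennreal (log_cutoff R x)" \<mu>] nn_integral_log_cutoff[OF R]
    by (simp add: h_def)
  have first: "(\<integral>\<^sup>+\<omega>. S \<omega> \<partial>M) = ennreal (2 * R - 2)"
    unfolding S_def using sine_process_first_moment[OF X, of "\<lambda>x. ennreal (h x)"] int_h by simp
  \<comment> \<open>The finite mean confines the default value of \<open>enn2real\<close> to a null
    set.\<close>
  have "AE \<omega> in M. S \<omega> \<noteq> \<infinity>"
    by (rule nn_integral_PInf_AE[OF S]) (simp add: first)
  then have AE_Y: "AE \<omega> in M. ennreal (Y \<omega>) = S \<omega>"
    by eventually_elim (simp add: Y_S ennreal_enn2real less_top)
  define F where "F x y = ennreal ((log_cutoff R x - log_cutoff R y)\<^sup>2 * sinc_square (x - y))" for x y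
  have "(\<integral>\<^sup>+x. \<integral>\<^sup>+y. ennreal ((h x - h y)\<^sup>2 * sinc_square (x - y)) \<partial>lborel \<partial>lborel) =
      (\<integral>\<^sup>+x. \<integral>\<^sup>+y. F (x - \<mu>) (y - \<mu>) \<partial>lborel \<partial>lborel)"
    by (simp add: F_def h_def)
  also have "\<dots> = (\<integral>\<^sup>+x. \<integral>\<^sup>+y. F (x - \<mu>) y \<partial>lborel \<partial>lborel)"
    by (intro nn_integral_cong nn_integral_lborel_translate) (simp add: F_def)
  also have "\<dots> = (\<integral>\<^sup>+x. \<integral>\<^sup>+y. F x y \<partial>lborel \<partial>lborel)"
    by (rule nn_integral_lborel_translate) (simp add: F_def)
  also have "\<dots> \<le> ennreal (2048 * ln (1 + R))"
    unfolding F_def by (rule log_cutoff_energy_le[OF R])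
  finally have V: "(\<integral>\<^sup>+x. \<integral>\<^sup>+y. ennreal ((h x - h y)\<^sup>2 * sinc_square (x - y)) \<partial>lborel \<partial>lborel) \<le> ennreal (2048 * ln (1 + R))" .
  have "2 * (\<integral>\<^sup>+\<omega>. (S \<omega>)\<^sup>2 \<partial>M) \<le> 2 * (ennreal (2 * R - 2))\<^sup>2 + ennreal (2048 * ln (1 + R))"
    using sine_process_second_moment_le[OF X h] V int_h
    by (auto simp: S_def h_def log_cutoff_nonneg intro: order_trans add_left_mono)
  also have "\<dots> = 2 * ennreal ((2 * R - 2)\<^sup>2 + 1024 * ln (1 + R))"
    using R by (simp add: ennreal_power distrib_left ennreal_mult'[symmetric] flip: ennreal_numeral)
  finally have "(\<integral>\<^sup>+\<omega>. (S \<omega>)\<^sup>2 \<partial>M) \<le> ennreal ((2 * R - 2)\<^sup>2 + 1024 * ln (1 + R))"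
    by (subst (asm) ennreal_mult_le_mult_iff) auto
  moreover have "(\<integral>\<^sup>+\<omega>. (S \<omega>)\<^sup>2 \<partial>M) = (\<integral>\<^sup>+\<omega>. ennreal ((Y \<omega>)\<^sup>2) \<partial>M)"
    using AE_Y by (intro nn_integral_cong_AE, eventually_elim) (simp add: ennreal_power[symmetric] Y_S)
  ultimately have second: "(\<integral>\<^sup>+\<omega>. ennreal ((Y \<omega>)\<^sup>2) \<partial>M) \<le> ennreal ((2 * R - 2)\<^sup>2 + 1024 * ln (1 + R))"
    by simp
  then have int2: "integrable M (\<lambda>\<omega>. (Y \<omega>)\<^sup>2)"
    by (intro integrableI_bounded) (auto simp: le_less_trans ennreal_less_top)
  have "(\<integral>\<^sup>+\<omega>. ennreal (Y \<omega>) \<partial>M) = ennreal (2 * R - 2)"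
    using AE_Y first by (simp cong: nn_integral_cong_AE)
  then have EY: "expectation Y = 2 * R - 2"
    using R by (subst integral_eq_nn_integral) (auto simp: Y_S)
  have "expectation (\<lambda>\<omega>. (Y \<omega>)\<^sup>2) \<le> (2 * R - 2)\<^sup>2 + 1024 * ln (1 + R)"
    using second R by (subst integral_eq_nn_integral) (auto intro!: enn2real_leI)
  then have "variance Y \<le> 1024 * ln (1 + R)"
    using variance_eq[OF square_integrable_imp_integrable[OF Y int2] int2] EY by simp
  then have "variance Y / a\<^sup>2 \<le> 1024 * ln (1 + R) / a\<^sup>2" by (intro divide_right_mono) auto
  with Chebyshev_inequality[OF Y int2 a]
  have "measure M {\<omega> \<in> space M. a \<le> \<bar>Y \<omega> - expectation Y\<bar>} \<le> 1024 * ln (1 + R) / a\<^sup>2" by (rule order_trans)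
  then show ?thesis unfolding EY Y_def .
qed

text \<open>At \<open>R = exp m\<close> with \<open>m = (real (Suc n))\<^sup>2\<close>, a deviation
  of \<open>m / 4\<close> has probability at most
  \<open>1024 * (2 * m) / (m / 4)\<^sup>2 = 32768 / m\<close>, which is summable in
  \<open>n\<close>. Using \<open>Suc n\<close> keeps the deviation positive.\<close>

lemma AE_log_statistic_ge:
  assumes X: "sine_process M X"
  shows "AE \<omega> in M. eventually (\<lambda>n. 2 * exp ((real (Suc n))\<^sup>2) - 2 - (real (Suc n))\<^sup>2 / 4
    \<le> log_statistic (exp ((real (Suc n))\<^sup>2)) \<mu> (X \<omega>)) sequentially"
proof -
  have PP: "point_process M X" by (rule sine_process_point_process[OF X])
  then interpret prob_space M by (simp add: point_process_def)
  define R where "R n = exp ((real (Suc n))\<^sup>2)" for n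
  define A where "A n = {\<omega> \<in> space M. (real (Suc n))\<^sup>2 / 4 \<le> \<bar>log_statistic (R n) \<mu> (X \<omega>) - (2 * R n - 2)\<bar>}" for n
  have A [measurable]: "A n \<in> sets M" for n
    using measurable_log_statistic[OF PP, of "R n" \<mu>] unfolding A_def by measurable
  have bound: "measure M (A n) \<le> 32768 * inverse ((real (Suc n))\<^sup>2)" for n
  proof -
    define m where "m = (real (Suc n))\<^sup>2"
    have m: "1 \<le> m" unfolding m_def by (intro one_le_power) simp
    have "1 + exp m \<le> exp 1 * exp m"
    proof -
      have "(2::real) \<le> exp 1" using exp_ge_add_one_self[of 1] by simp
      then have "2 * exp m \<le> exp 1 * exp m" by (intro mult_right_mono) auto
      moreover have "1 \<le> exp m" using m by simp
      ultimately show ?thesis by linarith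
    qed
    then have "ln (1 + exp m) \<le> ln (exp 1 * exp m)" by (intro ln_mono) (auto simp: add_pos_pos)
    also have "\<dots> = 1 + m" by (simp add: ln_mult)
    finally have ln: "ln (1 + exp m) \<le> 2 * m" using m by simp
    have "measure M (A n) \<le> 1024 * ln (1 + R n) / (m / 4)\<^sup>2"
      unfolding A_def m_def[symmetric] using m by (intro log_statistic_deviation X) (simp_all add: R_def)
    also have "\<dots> \<le> 1024 * (2 * m) / (m / 4)\<^sup>2"
      using ln unfolding R_def m_def[symmetric] by (intro divide_right_mono mult_left_mono) simp_all
    also have "\<dots> = 32768 * inverse m" using m by (simp add: power2_eq_square field_simps)
    finally show ?thesis by (simp add: m_def)
  qed
  have "summable (\<lambda>n. inverse ((real n)\<^sup>2))" by (rule inverse_power_summable) simp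
  then have "summable (\<lambda>n. inverse ((real (Suc n))\<^sup>2))" by (subst summable_Suc_iff)
  then have "summable (\<lambda>n. 32768 * inverse ((real (Suc n))\<^sup>2))" by (rule summable_mult)
  moreover have "norm (measure M (A n)) \<le> 32768 * inverse ((real (Suc n))\<^sup>2)" for n
    using bound[of n] by (simp only: real_norm_def abs_of_nonneg measure_nonneg)
  ultimately have "summable (\<lambda>n. measure M (A n))" by (rule summable_comparison_test')
  then have "AE \<omega> in M. eventually (\<lambda>n. \<omega> \<in> space M - A n) sequentially"
    by (rule borel_cantelli_AE1[rotated 2]) (simp_all add: emeasure_eq_measure)
  then show ?thesis
  proof (rule AE_mp, intro AE_I2 impI)
    fix \<omega> assume "\<omega> \<in> space M" "eventually (\<lambda>n. \<omega> \<in> space M - A n) sequentially"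
    from this(2) show "eventually (\<lambda>n. 2 * exp ((real (Suc n))\<^sup>2) - 2 - (real (Suc n))\<^sup>2 / 4
        \<le> log_statistic (exp ((real (Suc n))\<^sup>2)) \<mu> (X \<omega>)) sequentially"
    proof (rule eventually_mono)
      fix n assume "\<omega> \<in> space M - A n"
      then have "\<not> (real (Suc n))\<^sup>2 / 4 \<le> \<bar>log_statistic (R n) \<mu> (X \<omega>) - (2 * R n - 2)\<bar>"
        unfolding A_def by blast
      then show "2 * exp ((real (Suc n))\<^sup>2) - 2 - (real (Suc n))\<^sup>2 / 4
          \<le> log_statistic (exp ((real (Suc n))\<^sup>2)) \<mu> (X \<omega>)"
        unfolding R_def by linarith
    qed
  qed
qed

theorem theorem1p1:
  fixes M :: "'w measure" and \<Lambda> :: "'w \<Rightarrow> real set"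
  assumes "sine_process M \<Lambda>"
  shows "AE \<omega> in M. spans_L2 (lebesgue_on {-pi..pi}) (exponential ` \<Lambda> \<omega>)"
proof -
  \<comment> \<open>Each centre has its own exceptional null set; countability of the rationals
    keeps the union null.\<close>
  have "AE \<omega> in M. \<forall>\<mu>\<in>\<rat>. eventually (\<lambda>n. 2 * exp ((real (Suc n))\<^sup>2) - 2 - (real (Suc n))\<^sup>2 / 4
      \<le> log_statistic (exp ((real (Suc n))\<^sup>2)) \<mu> (\<Lambda> \<omega>)) sequentially"
    by (subst AE_ball_countable[OF countable_rat]) (intro ballI AE_log_statistic_ge[OF assms])
  then show ?thesis
  proof (rule AE_mp, intro AE_I2 impI)
    fix \<omega> assume \<omega>: "\<omega> \<in> space M"
      and ev: "\<forall>\<mu>\<in>\<rat>. eventually (\<lambda>n. 2 * exp ((real (Suc n))\<^sup>2) - 2 - (real (Suc n))\<^sup>2 / 4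
        \<le> log_statistic (exp ((real (Suc n))\<^sup>2)) \<mu> (\<Lambda> \<omega>)) sequentially"
    let ?L = "\<Lambda> \<omega>"
    show "spans_L2 (lebesgue_on {-pi..pi}) (exponential ` ?L)"
    proof (rule spans_L2_exponentialI)
      fix \<mu> :: real assume \<mu>: "\<mu> \<in> \<rat>"
      let ?cl = "L2_closure (lebesgue_on {-pi..pi}) (cfun.span (exponential ` ?L))"
      show "exponential \<mu> \<in> ?cl"
      proof (cases "\<mu> \<in> ?L")
        case True
        then have "exponential \<mu> \<in> cfun.span (exponential ` ?L)" by (intro cfun.span_base) auto
        then show ?thesis
          using subset_L2_closure[OF span_subset_L2_space[OF exponential_in_L2_space]] by blast
      next
        case False
        have fin: "finite {l \<in> ?L. 0 < \<bar>l - \<mu>\<bar> \<and> \<bar>l - \<mu>\<bar> < R}" for R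
        proof (rule finite_subset)
          show "{l \<in> ?L. 0 < \<bar>l - \<mu>\<bar> \<and> \<bar>l - \<mu>\<bar> < R} \<subseteq> ?L \<inter> ball \<mu> R"
            by (auto simp: dist_real_def)
          show "finite (?L \<inter> ball \<mu> R)"
            using sine_process_point_process[OF assms] \<omega> by (simp add: point_process_def)
        qed
        show ?thesis
        proof (rule exponential_in_closureI[OF fin])
          fix C :: real
          \<comment> \<open>With \<open>m = (real (Suc n))\<^sup>2\<close>, the margin
            \<open>m / 12\<close> is the gain \<open>m / 3\<close> less the conceded deviation
            \<open>m / 4\<close>; the 2 comes from the mean \<open>2 * R - 2\<close> and
            \<open>ln 2 / 3\<close> from \<open>ln (R / 2) / 3\<close>.\<close>
          have "filterlim (\<lambda>n. (real (Suc n))\<^sup>2 / 12 - 2 - ln 2 / 3) at_top sequentially" by real_asymp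
          then have "eventually (\<lambda>n. C < (real (Suc n))\<^sup>2 / 12 - 2 - ln 2 / 3) sequentially"
            by (simp add: filterlim_at_top_dense)
          with ev \<mu> have "eventually (\<lambda>n. C < (real (Suc n))\<^sup>2 / 12 - 2 - ln 2 / 3 \<and>
              2 * exp ((real (Suc n))\<^sup>2) - 2 - (real (Suc n))\<^sup>2 / 4 \<le> log_statistic (exp ((real (Suc n))\<^sup>2)) \<mu> ?L) sequentially"
            by (auto intro: eventually_conj)
          then obtain n where n: "C < (real (Suc n))\<^sup>2 / 12 - 2 - ln 2 / 3"
              "2 * exp ((real (Suc n))\<^sup>2) - 2 - (real (Suc n))\<^sup>2 / 4 \<le> log_statistic (exp ((real (Suc n))\<^sup>2)) \<mu> ?L"
            using eventually_happens[of _ sequentially] by auto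
          define m where "m = (real (Suc n))\<^sup>2"
          define R where "R = exp m"
          have "1 \<le> m" unfolding m_def by (intro one_le_power) simp
          then have R: "2 \<le> R" unfolding R_def using exp_ge_add_one_self[of m] by linarith
          have "2 * R - 2 - m / 4 \<le> (\<Sum>l | l \<in> ?L \<and> 0 < \<bar>l - \<mu>\<bar> \<and> \<bar>l - \<mu>\<bar> < R. ln (R / \<bar>l - \<mu>\<bar>))"
            using n(2) log_statistic_le[OF _ fin False, of R] R unfolding m_def[symmetric] R_def[symmetric] by simp
          moreover have "ln (R / 2) = m - ln 2" by (simp add: R_def ln_div)
          moreover have "C < m / 12 - 2 - ln 2 / 3" using n(1) by (simp add: m_def)
          ultimately show "\<exists>R\<ge>2. C < (\<Sum>l | l \<in> ?L \<and> 0 < \<bar>l - \<mu>\<bar> \<and> \<bar>l - \<mu>\<bar> < R. ln (R / \<bar>l - \<mu>\<bar>)) - 2 * R + ln (R / 2) / 3"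
            using R by (intro exI[of _ R]) (simp add: field_simps)
        qed
      qed
    qed
  qed
qed

end
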